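(* For any connected graph $G$, put $$\lambda_{chr}(G)=\frac{dP_{chr}(G)}{dX}(0),$$ and extend $\lambda_{chr}$ to a character of $\mathcal{H}_{\mathcal{G}}$: for any graph $G$ with connected components $G_1,\ldots,G_k$, $\lambda_{chr}(G)=\lambda_{chr}(G_1)\cdots\lambda_{chr}(G_k)$. Then $\lambda_{chr}$ is an invertible element of the monoid $(M_{\mathcal{G}},* )$ of characters; denote its inverse by $\lambda_0$. For any graph $G$, $\lambda_0(G)=1$, or equivalently: $$\text{for every graph } G,\qquad \sum_{\sim\triangleleft G}\lambda_{chr}(G/\sim)=\sum_{\sim\triangleleft G}\lambda_{chr}(G|\sim)=\varepsilon'(G).$$ Moreover, $P_{chr}=\phi_0\leftarrow\lambda_{chr}$, or equivalently: $$\text{for every graph } G,\qquad P_{chr}(G)=\sum_{\sim\triangleleft G}\lambda_{chr}(G|\sim)\,X^{cl(\sim)}.$$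
   Context: A graph is a pair $G=(V(G),E(G))$ with $V(G)$ a finite set and $E(G)$ a set of $2$-element subsets of $V(G)$; graphs are considered up to isomorphism. The empty graph is denoted $1$ and is considered as non connected. $P_{chr}(G)\in\mathbb{Q}[X]$ is the chromatic polynomial: for $k\geq1$, $P_{chr}(G)(k)$ is the number of maps $f:V(G)\to\{1,\ldots,k\}$ with $f(x)\neq f(y)$ for every edge $\{x,y\}$; it is extended linearly to $\mathcal{H}_{\mathcal{G}}$. For $I\subseteq V(G)$, $G_{|I}$ is the induced subgraph on $I$. For an equivalence relation $\sim$ on $V(G)$: $cl(\sim)$ is its number of classes; $G/\sim$ is the graph with vertex set $V(G)/\sim$ and with an edge between two distinct classes if and only if some edge of $G$ joins an element of one to an element of the other; $G|\sim$ is the graph with $V(G|\sim)=V(G)$ and $E(G|\sim)=\{\{x,y\}\in E(G): x\sim y\}$; one writes $\sim\triangleleft G$ if $G_{|c}$ is connected for every class $c$ of $\sim$. $\mathcal{H}_{\mathcal{G}}$ is the $\mathbb{Q}$-vector space with basis the isoclasses of graphs, $m$ is disjoint union, and $\delta(G)=\sum_{\sim\triangleleft G}(G/\sim)\otimes(G|\sim)$. $(\mathcal{H}_{\mathcal{G}},m,\delta)$ is a bialgebra, with counit $\varepsilon'$ sending graphs without edges to $1$ and the others to $0$. $M_{\mathcal{G}}$ is the set of characters (unital algebra morphisms $\mathcal{H}_{\mathcal{G}}\to\mathbb{Q}$), a monoid for the convolution $\lambda*\mu=(\lambda\otimes\mu)\circ\delta$, with unit $\varepsilon'$. The linear map $\phi_0:\mathcal{H}_{\mathcal{G}}\to\mathbb{Q}[X]$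 is defined by $\phi_0(G)=X^{|V(G)|}$. For a linear map $\phi:\mathcal{H}_{\mathcal{G}}\to\mathbb{Q}[X]$ and $\lambda\in M_{\mathcal{G}}$, $\phi\leftarrow\lambda=(\phi\otimes\lambda)\circ\delta$. *)

theory Defs
  imports
    "HOL-Algebra.Group"
    "HOL-Computational_Algebra.Polynomial"
    "HOL-Library.Poly_Mapping"
    "HOL-Library.Countable_Set"
    "HOL-Library.FuncSet"
    "HOL-Library.Nat_Bijection"
begin

section \<open>Finite simple graphs\<close>

type_synonym 'a ugraph = "'a set \<times> 'a set set"

abbreviation verts :: "'a ugraph \<Rightarrow> 'a set" where "verts \<equiv> fst"
abbreviation edges :: "'a ugraph \<Rightarrow> 'a set set" where "edges \<equiv> snd"

definition fin_graph :: "'a ugraph \<Rightarrow> bool" where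
  "fin_graph G \<longleftrightarrow> finite (verts G) \<and> (\<forall>e\<in>edges G. e \<subseteq> verts G \<and> card e = 2)"

definition induced :: "'a ugraph \<Rightarrow> 'a set \<Rightarrow> 'a ugraph" where
  "induced G I = (I, {e \<in> edges G. e \<subseteq> I})"

definition adj_rel :: "'a ugraph \<Rightarrow> ('a \<times> 'a) set" where
  "adj_rel G = {(x, y). {x, y} \<in> edges G}"

text \<open>The empty graph is not connected.\<close>
definition gconnected :: "'a ugraph \<Rightarrow> bool" where
  "gconnected G \<longleftrightarrow> verts G \<noteq> {} \<and> (\<forall>x\<in>verts G. \<forall>y\<in>verts G. (x, y) \<in> (adj_rel G)\<^sup>*)"

text \<open>Vertex sets of the connected components.\<close>
definition components :: "'a ugraph \<Rightarrow> 'a set set" where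
  "components G = verts G // {(x, y) \<in> verts G \<times> verts G. (x, y) \<in> (adj_rel G)\<^sup>*}"

definition quot_graph :: "'a ugraph \<Rightarrow> ('a \<times> 'a) set \<Rightarrow> 'a set ugraph" where
  "quot_graph G r =
     (verts G // r,
      {{C, D} | C D. C \<in> verts G // r \<and> D \<in> verts G // r \<and> C \<noteq> D \<and>
                     (\<exists>x\<in>C. \<exists>y\<in>D. {x, y} \<in> edges G)})"

definition restr_graph :: "'a ugraph \<Rightarrow> ('a \<times> 'a) set \<Rightarrow> 'a ugraph" where
  "restr_graph G r = (verts G, {{x, y} | x y. {x, y} \<in> edges G \<and> (x, y) \<in> r})"

definition admissible :: "('a \<times> 'a) set \<Rightarrow> 'a ugraph \<Rightarrow> bool"  (infix \<open>\<triangleleft>\<close> 50) where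
  "r \<triangleleft> G \<longleftrightarrow> equiv (verts G) r \<and> (\<forall>c \<in> verts G // r. gconnected (induced G c))"

definition cl :: "'a ugraph \<Rightarrow> ('a \<times> 'a) set \<Rightarrow> nat" where
  "cl G r = card (verts G // r)"

definition colourings :: "'a ugraph \<Rightarrow> nat \<Rightarrow> ('a \<Rightarrow> nat) set" where
  "colourings G k = {f \<in> verts G \<rightarrow>\<^sub>E {1..k}. \<forall>x y. {x, y} \<in> edges G \<longrightarrow> f x \<noteq> f y}"

definition chrom_poly :: "'a ugraph \<Rightarrow> rat poly" where
  "chrom_poly G = (THE p. \<forall>k\<ge>1. poly p (of_nat k) = of_nat (card (colourings G k)))"

definition graph_iso :: "'a ugraph \<Rightarrow> 'b ugraph \<Rightarrow> bool"  (infix \<open>\<cong>\<^sub>g\<close> 50) where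
  "G \<cong>\<^sub>g H \<longleftrightarrow> (\<exists>f. bij_betw f (verts G) (verts H) \<and> edges H = (image f) ` edges G)"

definition relabel :: "('a \<Rightarrow> 'b) \<Rightarrow> 'a ugraph \<Rightarrow> 'b ugraph" where
  "relabel f G = (f ` verts G, (image f) ` edges G)"

definition disj_union :: "'a ugraph \<Rightarrow> 'b ugraph \<Rightarrow> ('a + 'b) ugraph" where
  "disj_union G H =
     (verts G <+> verts H, (image Inl) ` edges G \<union> (image Inr) ` edges H)"


subsection \<open>Invariance under isomorphism\<close>

lemma graph_iso_relabel: "G \<cong>\<^sub>g H \<longleftrightarrow> (\<exists>f. inj_on f (verts G) \<and> H = relabel f G)"
  unfolding graph_iso_def relabel_def bij_betw_def by (metis fst_conv prod.collapse snd_conv)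

lemma graph_iso_relabelI: "inj_on f (verts G) \<Longrightarrow> G \<cong>\<^sub>g relabel f G"
  by (auto simp: graph_iso_relabel)

lemma graph_isoI: "inj_on f (verts G) \<Longrightarrow> H = relabel f G \<Longrightarrow> G \<cong>\<^sub>g H"
  by (auto simp: graph_iso_relabel)

lemma relabel_sel [simp]:
  "verts (relabel f G) = f ` verts G" "edges (relabel f G) = (image f) ` edges G"
  by (simp_all add: relabel_def)

lemma fin_graph_edgeD: "fin_graph G \<Longrightarrow> e \<in> edges G \<Longrightarrow> e \<subseteq> verts G"
  by (auto simp: fin_graph_def)

lemma fin_graph_relabel:
  assumes "fin_graph G" "inj_on f (verts G)"
  shows "fin_graph (relabel f G)"
  using assms unfolding fin_graph_def
  by (auto simp: card_image inj_on_subset)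

lemma relabel_inv:
  assumes "fin_graph G" "inj_on f (verts G)"
  shows "relabel (inv_into (verts G) f) (relabel f G) = G"
proof -
  have "(image (inv_into (verts G) f)) ` (image f) ` edges G = id ` edges G"
    unfolding image_image[of "image _"]
    using assms by (intro image_cong refl) (auto simp: fin_graph_def inv_into_image_cancel)
  then show ?thesis using assms by (simp add: relabel_def inv_into_image_cancel)
qed

lemma relabel_comp: "relabel g (relabel f G) = relabel (g \<circ> f) G"
  by (simp add: relabel_def image_comp comp_def image_image)

lemma graph_iso_refl: "G \<cong>\<^sub>g G"
  by (auto simp: graph_iso_def intro: exI[of _ id])

lemma graph_iso_sym: "fin_graph G \<Longrightarrow> G \<cong>\<^sub>g H \<Longrightarrow> H \<cong>\<^sub>g G"
  unfolding graph_iso_relabel by (metis relabel_inv inj_on_inv_into relabel_sel(1) order_refl)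

lemma graph_iso_trans [trans]: "G \<cong>\<^sub>g H \<Longrightarrow> H \<cong>\<^sub>g K \<Longrightarrow> G \<cong>\<^sub>g K"
  unfolding graph_iso_relabel by (metis relabel_comp comp_inj_on relabel_sel(1))

lemma edge_relabel:
  assumes "fin_graph G" "inj_on f (verts G)" "x \<in> verts G" "y \<in> verts G"
  shows "{f x, f y} \<in> edges (relabel f G) \<longleftrightarrow> {x, y} \<in> edges G"
proof
  assume "{f x, f y} \<in> edges (relabel f G)"
  then obtain e where e: "e \<in> edges G" "f ` {x, y} = f ` e" by auto
  moreover have "e \<subseteq> verts G" using assms e by (auto simp: fin_graph_def)
  ultimately have "{x, y} = e" using assms inj_on_image_eq_iff[of f "verts G" "{x,y}" e] by auto
  then show "{x, y} \<in> edges G" using e by simp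
next
  assume "{x, y} \<in> edges G"
  then have "f ` {x, y} \<in> edges (relabel f G)" unfolding relabel_sel by (rule imageI)
  then show "{f x, f y} \<in> edges (relabel f G)" by simp
qed

lemma relabel_induced:
  assumes "fin_graph G" "inj_on f (verts G)" "C \<subseteq> verts G"
  shows "induced (relabel f G) (f ` C) = relabel f (induced G C)"
proof -
  have "f ` e \<subseteq> f ` C \<longleftrightarrow> e \<subseteq> C" if "e \<in> edges G" for e
    using fin_graph_edgeD[OF assms(1) that] assms(2,3) by (metis inj_on_image_mem_iff image_mono image_subset_iff subset_iff)
  then show ?thesis by (auto simp: induced_def relabel_def)
qed

lemma fin_graph_induced: "fin_graph G \<Longrightarrow> C \<subseteq> verts G \<Longrightarrow> fin_graph (induced G C)"
  by (auto simp: fin_graph_def induced_def finite_subset)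

lemma adj_rtrancl_relabel1:
  assumes "(x, y) \<in> (adj_rel G)\<^sup>*"
  shows "(f x, f y) \<in> (adj_rel (relabel f G))\<^sup>*"
  using assms
proof (induction rule: rtrancl_induct)
  case (step y z)
  have "{f y, f z} = f ` {y, z}" by simp
  then have "(f y, f z) \<in> adj_rel (relabel f G)"
    using step by (auto simp: adj_rel_def simp del: image_insert)
  then show ?case using step by (meson rtrancl.rtrancl_into_rtrancl)
qed simp

lemma adj_rtrancl_relabel:
  assumes "fin_graph G" "inj_on f (verts G)" "x \<in> verts G" "y \<in> verts G"
  shows "(f x, f y) \<in> (adj_rel (relabel f G))\<^sup>* \<longleftrightarrow> (x, y) \<in> (adj_rel G)\<^sup>*"
  using adj_rtrancl_relabel1[of x y G f]
    adj_rtrancl_relabel1[of "f x" "f y" "relabel f G" "inv_into (verts G) f"] assms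
  by (auto simp: relabel_inv)

lemma gconnected_relabel:
  assumes "fin_graph G" "inj_on f (verts G)"
  shows "gconnected (relabel f G) \<longleftrightarrow> gconnected G"
  using assms by (auto simp: gconnected_def adj_rtrancl_relabel)

lemma quotient_image:
  assumes "inj_on f A" "r \<subseteq> A \<times> A"
  shows "(f ` A) // (map_prod f f ` r) = (image f) ` (A // r)"
proof -
  have "(map_prod f f ` r) `` {f x} = f ` (r `` {x})" if "x \<in> A" for x
  proof
    show "(map_prod f f ` r) `` {f x} \<subseteq> f ` (r `` {x})"
      using that assms by (auto simp: inj_on_eq_iff)
  qed force
  then show ?thesis by (auto simp: quotient_def)
qed

lemma components_relabel:
  assumes "fin_graph G" "inj_on f (verts G)"
  shows "components (relabel f G) = (image f) ` components G"
proof -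
  have "{(x, y) \<in> f ` verts G \<times> f ` verts G. (x, y) \<in> (adj_rel (relabel f G))\<^sup>*} =
    map_prod f f ` {(x, y) \<in> verts G \<times> verts G. (x, y) \<in> (adj_rel G)\<^sup>*}"
    using adj_rtrancl_relabel[OF assms] by (auto simp: image_iff)
  then show ?thesis
    unfolding components_def relabel_sel using assms by (subst quotient_image[symmetric]) auto
qed

lemma component_subset: "C \<in> components G \<Longrightarrow> C \<subseteq> verts G"
  by (auto simp: components_def quotient_def)

lemma quot_graph_relabel:
  assumes "fin_graph G" "inj_on f (verts G)" "equiv (verts G) r"
  shows "quot_graph (relabel f G) (map_prod f f ` r) = relabel (image f) (quot_graph G r)"
proof -
  have r: "r \<subseteq> verts G \<times> verts G" using assms by (auto simp: equiv_def)
  have sub: "C \<subseteq> verts G" if "C \<in> verts G // r" for C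
    using that r by (auto simp: quotient_def)
  have ex: "(\<exists>x\<in>f ` C. \<exists>y\<in>f ` D. {x, y} \<in> edges (relabel f G)) \<longleftrightarrow>
    (\<exists>x\<in>C. \<exists>y\<in>D. {x, y} \<in> edges G)" if "C \<subseteq> verts G" "D \<subseteq> verts G" for C D
    using that edge_relabel[OF assms(1,2)] by (simp del: relabel_sel) blast
  have eq: "f ` C = f ` D \<longleftrightarrow> C = D" if "C \<subseteq> verts G" "D \<subseteq> verts G" for C D
    using that assms(2) inj_on_image_eq_iff by blast
  have "{{C, D} | C D. C \<in> (image f) ` (verts G // r) \<and> D \<in> (image f) ` (verts G // r) \<and> C \<noteq> D \<and>
          (\<exists>x\<in>C. \<exists>y\<in>D. {x, y} \<in> edges (relabel f G))} =
      (image (image f)) ` {{C, D} | C D. C \<in> verts G // r \<and> D \<in> verts G // r \<and> C \<noteq> D \<and>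
          (\<exists>x\<in>C. \<exists>y\<in>D. {x, y} \<in> edges G)}" (is "?L = ?R")
  proof
    show "?L \<subseteq> ?R"
    proof
      fix X assume "X \<in> ?L"
      then obtain C D where CD: "X = {f ` C, f ` D}" "C \<in> verts G // r" "D \<in> verts G // r"
        "f ` C \<noteq> f ` D" "\<exists>x\<in>f ` C. \<exists>y\<in>f ` D. {x, y} \<in> edges (relabel f G)" by blast
      have "C \<noteq> D" "\<exists>x\<in>C. \<exists>y\<in>D. {x, y} \<in> edges G"
        using CD(4) ex[OF sub[OF CD(2)] sub[OF CD(3)]] CD(5) by (metis, metis)
      then have "{C, D} \<in> {{C, D} | C D. C \<in> verts G // r \<and> D \<in> verts G // r \<and> C \<noteq> D \<and>
          (\<exists>x\<in>C. \<exists>y\<in>D. {x, y} \<in> edges G)}"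
        using CD(2,3) by (intro CollectI exI[of _ C] exI[of _ D] conjI refl)
      then show "X \<in> ?R" by (rule rev_image_eqI) (simp add: CD(1))
    qed
    show "?R \<subseteq> ?L"
    proof
      fix X assume "X \<in> ?R"
      then obtain C D where CD: "X = {f ` C, f ` D}" "C \<in> verts G // r" "D \<in> verts G // r"
        "C \<noteq> D" "\<exists>x\<in>C. \<exists>y\<in>D. {x, y} \<in> edges G" by auto
      have "f ` C \<noteq> f ` D" "\<exists>x\<in>f ` C. \<exists>y\<in>f ` D. {x, y} \<in> edges (relabel f G)"
        using CD(4,5) ex[OF sub[OF CD(2)] sub[OF CD(3)]] eq[OF sub[OF CD(2)] sub[OF CD(3)]]
        by (metis, metis)
      then show "X \<in> ?L"
        using CD(2,3) unfolding CD(1)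
        by (intro CollectI exI[of _ "f ` C"] exI[of _ "f ` D"] conjI refl imageI)
    qed
  qed
  then show ?thesis
    unfolding quot_graph_def relabel_sel(1) quotient_image[OF assms(2) r]
    by (simp add: relabel_def)
qed

lemma restr_graph_relabel:
  assumes "fin_graph G" "inj_on f (verts G)" "equiv (verts G) r"
  shows "restr_graph (relabel f G) (map_prod f f ` r) = relabel f (restr_graph G r)"
proof -
  have r: "x \<in> verts G \<and> y \<in> verts G" if "(x, y) \<in> r" for x y
    using assms that by (auto simp: equiv_def)
  have "{{x, y} | x y. {x, y} \<in> edges (relabel f G) \<and> (x, y) \<in> map_prod f f ` r} =
    (image f) ` {{x, y} | x y. {x, y} \<in> edges G \<and> (x, y) \<in> r}" (is "?L = ?R")
  proof
    show "?L \<subseteq> ?R"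
    proof
      fix e assume "e \<in> ?L"
      then obtain x y where e: "e = {f x, f y}" "(x, y) \<in> r" "{f x, f y} \<in> edges (relabel f G)" by auto
      then have "{x, y} \<in> edges G" using edge_relabel[OF assms(1,2)] r by blast
      then have "{x, y} \<in> {{x, y} | x y. {x, y} \<in> edges G \<and> (x, y) \<in> r}"
        using e(2) by (intro CollectI exI[of _ x] exI[of _ y] conjI refl)
      then show "e \<in> ?R" by (rule rev_image_eqI) (simp add: e(1))
    qed
    show "?R \<subseteq> ?L"
    proof
      fix e assume "e \<in> ?R"
      then obtain x y where e: "e = {f x, f y}" "(x, y) \<in> r" "{x, y} \<in> edges G" by auto
      then have "{f x, f y} \<in> edges (relabel f G)" using edge_relabel[OF assms(1,2)] r by blast
      moreover have "(f x, f y) \<in> map_prod f f ` r" using e by (auto intro: rev_image_eqI)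
      ultimately show "e \<in> ?L"
        unfolding e(1) by (intro CollectI exI[of _ "f x"] exI[of _ "f y"] conjI refl)
    qed
  qed
  then show ?thesis by (simp add: restr_graph_def relabel_def)
qed

lemma admissible_relabel1:
  assumes "fin_graph G" "inj_on f (verts G)" "r \<triangleleft> G"
  shows "map_prod f f ` r \<triangleleft> relabel f G"
proof -
  have eq: "equiv (verts G) r" using assms by (simp add: admissible_def)
  then have r: "r \<subseteq> verts G \<times> verts G" by (auto simp: equiv_def)
  have "equiv (f ` verts G) (map_prod f f ` r)"
  proof (rule equivI)
    show "map_prod f f ` r \<subseteq> f ` verts G \<times> f ` verts G" using r by auto
    show "refl_on (f ` verts G) (map_prod f f ` r)"
      using eq by (auto simp: equiv_def refl_on_def intro: rev_image_eqI)
    show "sym (map_prod f f ` r)"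
      using eq by (auto simp: equiv_def sym_def intro: rev_image_eqI)
    show "trans (map_prod f f ` r)"
    proof (rule transI)
      fix a b c assume "(a, b) \<in> map_prod f f ` r" "(b, c) \<in> map_prod f f ` r"
      then obtain x y y' z where *: "(x, y) \<in> r" "(y', z) \<in> r" "a = f x" "b = f y" "b = f y'" "c = f z"
        by auto
      then have "y = y'" using r assms(2) by (meson SigmaD1 SigmaD2 inj_onD subsetD)
      then have "(x, z) \<in> r" using * eq by (auto simp: equiv_def dest: transD)
      then show "(a, c) \<in> map_prod f f ` r" using * by (auto intro: rev_image_eqI)
    qed
  qed
  moreover have "gconnected (induced (relabel f G) (f ` c))" if "c \<in> verts G // r" for c
  proof -
    have c: "c \<subseteq> verts G" using that r by (auto simp: quotient_def)
    have "inj_on f (verts (induced G c))"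
      using c assms(2) by (auto simp: induced_def intro: inj_on_subset)
    then show ?thesis
      using that assms c by (simp add: relabel_induced gconnected_relabel fin_graph_induced admissible_def)
  qed
  ultimately show ?thesis
    by (auto simp: admissible_def quotient_image[OF assms(2) r])
qed

lemma bij_betw_admissible:
  assumes "fin_graph G" "inj_on f (verts G)"
  shows "bij_betw (image (map_prod f f)) {r. r \<triangleleft> G} {r. r \<triangleleft> relabel f G}"
proof (rule bij_betw_byWitness[where f' = "image (map_prod (inv_into (verts G) f) (inv_into (verts G) f))"])
  let ?g = "inv_into (verts G) f"
  have g: "fin_graph (relabel f G)" "inj_on ?g (verts (relabel f G))" "relabel ?g (relabel f G) = G"
    using assms by (auto simp: fin_graph_relabel relabel_inv inj_on_inv_into)
  show "(image (map_prod f f)) ` {r. r \<triangleleft> G} \<subseteq> {r. r \<triangleleft> relabel f G}"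
    using admissible_relabel1[OF assms] by auto
  show "(image (map_prod ?g ?g)) ` {r. r \<triangleleft> relabel f G} \<subseteq> {r. r \<triangleleft> G}"
    using admissible_relabel1[OF g(1,2)] g(3) by auto
  show "\<forall>r\<in>{r. r \<triangleleft> G}. map_prod ?g ?g ` map_prod f f ` r = r"
  proof clarify
    fix r assume "r \<triangleleft> G"
    then have "\<forall>p\<in>r. map_prod ?g ?g (map_prod f f p) = p"
      using assms by (auto simp: admissible_def equiv_def)
    then show "map_prod ?g ?g ` map_prod f f ` r = r" by (simp add: image_image)
  qed
  show "\<forall>r\<in>{r. r \<triangleleft> relabel f G}. map_prod f f ` map_prod ?g ?g ` r = r"
  proof clarify
    fix r assume "r \<triangleleft> relabel f G"
    then have "r \<subseteq> f ` verts G \<times> f ` verts G" by (auto simp: admissible_def equiv_def)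
    then have "\<forall>p\<in>r. map_prod f f (map_prod ?g ?g p) = p"
      by (auto simp: f_inv_into_f subset_iff)
    then show "map_prod f f ` map_prod ?g ?g ` r = r" by (simp add: image_image)
  qed
qed

lemma card_colourings_relabel:
  assumes "fin_graph G" "inj_on f (verts G)"
  shows "card (colourings (relabel f G) k) = card (colourings G k)"
proof (rule bij_betw_same_card[of "\<lambda>c. restrict (c \<circ> f) (verts G)"],
    rule bij_betw_byWitness[where f' = "\<lambda>c. restrict (c \<circ> inv_into (verts G) f) (f ` verts G)"])
  have V: "x \<in> verts G" "y \<in> verts G" if "{x, y} \<in> edges G" for x y
    using that assms by (auto simp: fin_graph_def)
  have V': "x \<in> f ` verts G" "y \<in> f ` verts G" if "{x, y} \<in> (image f) ` edges G" for x y
    using that fin_graph_edgeD[OF fin_graph_relabel[OF assms], of "{x, y}"] by auto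
  have E: "{f x, f y} \<in> (image f) ` edges G" if "{x, y} \<in> edges G" for x y
    using that edge_relabel[OF assms] V by simp
  let ?g = "inv_into (verts G) f"
  have E': "{?g x, ?g y} \<in> edges G" if xy: "{x, y} \<in> (image f) ` edges G" for x y
  proof -
    obtain u v where "x = f u" "y = f v" "u \<in> verts G" "v \<in> verts G"
      using V'(1)[OF xy] V'(2)[OF xy] by auto
    then show ?thesis using xy edge_relabel[OF assms] assms(2) by simp
  qed
  show "\<forall>c\<in>colourings (relabel f G) k.
      restrict (restrict (c \<circ> f) (verts G) \<circ> ?g) (f ` verts G) = c"
    by (auto simp: colourings_def fun_eq_iff restrict_def PiE_def extensional_def f_inv_into_f inv_into_into)
  show "\<forall>c\<in>colourings G k. restrict (restrict (c \<circ> ?g) (f ` verts G) \<circ> f) (verts G) = c"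
    using assms by (auto simp: colourings_def fun_eq_iff restrict_def PiE_def extensional_def)
  show "(\<lambda>c. restrict (c \<circ> f) (verts G)) ` colourings (relabel f G) k \<subseteq> colourings G k"
    using E V by (fastforce simp: colourings_def)
  show "(\<lambda>c. restrict (c \<circ> ?g) (f ` verts G)) ` colourings G k \<subseteq> colourings (relabel f G) k"
  proof clarify
    fix c assume c: "c \<in> colourings G k"
    have "restrict (c \<circ> ?g) (f ` verts G) \<in> f ` verts G \<rightarrow>\<^sub>E {1..k}"
      using c assms(2) by (auto simp: colourings_def PiE_iff)
    moreover have "restrict (c \<circ> ?g) (f ` verts G) x \<noteq> restrict (c \<circ> ?g) (f ` verts G) y"
      if "{x, y} \<in> (image f) ` edges G" for x y
      using E'[OF that] V'[OF that] c by (auto simp: colourings_def)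
    ultimately show "restrict (c \<circ> ?g) (f ` verts G) \<in> colourings (relabel f G) k"
      by (auto simp: colourings_def)
  qed
qed

lemma chrom_poly_relabel:
  "fin_graph G \<Longrightarrow> inj_on f (verts G) \<Longrightarrow> chrom_poly (relabel f G) = chrom_poly G"
  by (simp add: chrom_poly_def card_colourings_relabel)

lemma fin_graph_quot_graph:
  assumes "fin_graph G"
  shows "fin_graph (quot_graph G r)"
proof -
  have "finite (verts G // r)" using assms by (simp add: fin_graph_def quotient_def)
  then show ?thesis by (auto simp: fin_graph_def quot_graph_def card_insert_if)
qed

lemma fin_graph_restr_graph:
  assumes "fin_graph G"
  shows "fin_graph (restr_graph G r)"
  using assms by (auto simp: fin_graph_def restr_graph_def)

lemma fin_graph_disj_union:
  assumes "fin_graph G" "fin_graph H"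
  shows "fin_graph (disj_union G H)"
  using assms unfolding fin_graph_def disj_union_def by (auto simp: card_image)

lemma disj_union_cong:
  assumes "G \<cong>\<^sub>g G'" "H \<cong>\<^sub>g H'"
  shows "disj_union G H \<cong>\<^sub>g disj_union G' H'"
proof -
  obtain f g where fg: "inj_on f (verts G)" "G' = relabel f G" "inj_on g (verts H)" "H' = relabel g H"
    using assms by (auto simp: graph_iso_relabel)
  have "disj_union G' H' = relabel (map_sum f g) (disj_union G H)"
    by (simp add: fg(2,4) disj_union_def relabel_def image_Un image_image Plus_def)
  moreover have "inj_on (map_sum f g) (verts (disj_union G H))"
    by (rule inj_onI) (auto simp: disj_union_def dest: inj_onD[OF fg(1)] inj_onD[OF fg(3)])
  ultimately show ?thesis by (rule graph_isoI[rotated])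
qed

lemma disj_union_comm: "disj_union G H \<cong>\<^sub>g disj_union H G"
proof -
  have "disj_union H G = relabel (case_sum Inr Inl) (disj_union G H)"
    by (auto simp: disj_union_def relabel_def image_Un image_image Plus_def)
  moreover have "inj_on (case_sum Inr Inl) (verts (disj_union G H))"
    by (auto simp: inj_on_def split: sum.splits)
  ultimately show ?thesis by (rule graph_isoI[rotated])
qed

lemma disj_union_assoc: "disj_union (disj_union G H) K \<cong>\<^sub>g disj_union G (disj_union H K)"
proof -
  let ?f = "case_sum (case_sum Inl (Inr \<circ> Inl)) (Inr \<circ> Inr)"
  have "disj_union G (disj_union H K) = relabel ?f (disj_union (disj_union G H) K)"
    by (auto simp: disj_union_def relabel_def image_Un image_image Plus_def)
  moreover have "inj_on ?f (verts (disj_union (disj_union G H) K))"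
    by (auto simp: inj_on_def split: sum.splits)
  ultimately show ?thesis by (rule graph_isoI[rotated])
qed

lemma disj_union_empty:
  fixes G :: "'a ugraph"
  shows "G \<cong>\<^sub>g disj_union (({}, {}) :: 'b ugraph) G"
proof -
  have "disj_union (({}, {}) :: 'b ugraph) G = relabel Inr G"
    by (auto simp: disj_union_def relabel_def)
  moreover have "inj_on (Inr :: 'a \<Rightarrow> 'b + 'a) (verts G)" by simp
  ultimately show ?thesis by (rule graph_isoI[rotated])
qed


section \<open>Isomorphism classes\<close>

text \<open>Every finite graph is isomorphic to one whose vertices are natural numbers.\<close>
quotient_type igraph = "nat ugraph" / partial: "\<lambda>G H. fin_graph G \<and> fin_graph H \<and> G \<cong>\<^sub>g H"
proof (rule part_equivpI)
  show "\<exists>G :: nat ugraph. fin_graph G \<and> fin_graph G \<and> G \<cong>\<^sub>g G"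
    by (intro exI[of _ "({}, {})"]) (simp add: fin_graph_def graph_iso_refl)
  show "symp (\<lambda>G H :: nat ugraph. fin_graph G \<and> fin_graph H \<and> G \<cong>\<^sub>g H)"
    by (rule sympI) (simp add: graph_iso_sym)
  show "transp (\<lambda>G H :: nat ugraph. fin_graph G \<and> fin_graph H \<and> G \<cong>\<^sub>g H)"
    by (rule transpI) (metis graph_iso_trans)
qed

definition iclass :: "'a ugraph \<Rightarrow> igraph" where
  "iclass G = abs_igraph (relabel (to_nat_on (verts G)) G)"

lemma nat_copy:
  assumes "fin_graph G"
  shows "fin_graph (relabel (to_nat_on (verts G)) G)" "G \<cong>\<^sub>g relabel (to_nat_on (verts G)) G"
proof -
  have "inj_on (to_nat_on (verts G)) (verts G)"
    using assms by (intro inj_on_to_nat_on) (auto simp: fin_graph_def countable_finite)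
  then show "fin_graph (relabel (to_nat_on (verts G)) G)" "G \<cong>\<^sub>g relabel (to_nat_on (verts G)) G"
    by (rule fin_graph_relabel[OF assms], rule graph_iso_relabelI)
qed

lemma abs_igraph_eq_iff:
  assumes "fin_graph G" "fin_graph H"
  shows "abs_igraph G = abs_igraph H \<longleftrightarrow> G \<cong>\<^sub>g H"
  using Quotient3_rel[OF Quotient3_igraph, of G H] assms by (simp add: graph_iso_refl)

lemma iclass_eq_iff:
  assumes "fin_graph G" "fin_graph H"
  shows "iclass G = iclass H \<longleftrightarrow> G \<cong>\<^sub>g H"
proof -
  let ?G = "relabel (to_nat_on (verts G)) G" and ?H = "relabel (to_nat_on (verts H)) H"
  note a = nat_copy[OF assms(1)] and b = nat_copy[OF assms(2)]
  have "iclass G = iclass H \<longleftrightarrow> ?G \<cong>\<^sub>g ?H"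
    unfolding iclass_def by (rule abs_igraph_eq_iff[OF a(1) b(1)])
  also have "\<dots> \<longleftrightarrow> G \<cong>\<^sub>g H"
  proof
    assume "?G \<cong>\<^sub>g ?H"
    then have "G \<cong>\<^sub>g ?H" by (rule graph_iso_trans[OF a(2)])
    then show "G \<cong>\<^sub>g H" by (rule graph_iso_trans[OF _ graph_iso_sym[OF assms(2) b(2)]])
  next
    assume "G \<cong>\<^sub>g H"
    then have "G \<cong>\<^sub>g ?H" by (rule graph_iso_trans[OF _ b(2)])
    then show "?G \<cong>\<^sub>g ?H" by (rule graph_iso_trans[OF graph_iso_sym[OF assms(1) a(2)]])
  qed
  finally show ?thesis .
qed

lemma iclass_nat:
  assumes "fin_graph (G :: nat ugraph)"
  shows "iclass G = abs_igraph G"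
  unfolding iclass_def
  by (rule abs_igraph_eq_iff[THEN iffD2])
    (rule nat_copy(1)[OF assms], rule assms, rule graph_iso_sym[OF assms nat_copy(2)[OF assms]])

lemma iclass_surj: "\<exists>G :: nat ugraph. fin_graph G \<and> iclass G = c"
proof (induction c rule: igraph.abs_induct)
  case (1 G)
  then show ?case using iclass_nat[of G] by (intro exI[of _ G]) simp
qed

lemma iclass_relabel:
  assumes "fin_graph G" "inj_on f (verts G)"
  shows "iclass (relabel f G) = iclass G"
  by (rule iclass_eq_iff[THEN iffD2])
    (rule fin_graph_relabel[OF assms], rule assms(1),
     rule graph_iso_sym[OF assms(1) graph_iso_relabelI[OF assms(2)]])

lemma sum_encode_copy:
  assumes "fin_graph G"
  shows "fin_graph (relabel sum_encode G)" "G \<cong>\<^sub>g relabel sum_encode G" "relabel sum_encode G \<cong>\<^sub>g G"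
proof -
  have e: "inj_on sum_encode (verts G)" by (rule inj_on_subset[OF inj_sum_encode subset_UNIV])
  show "fin_graph (relabel sum_encode G)" by (rule fin_graph_relabel[OF assms e])
  show "G \<cong>\<^sub>g relabel sum_encode G" by (rule graph_iso_relabelI[OF e])
  then show "relabel sum_encode G \<cong>\<^sub>g G" by (rule graph_iso_sym[OF assms])
qed

text \<open>The isomorphism classes form a commutative monoid under disjoint union, written additively
  so that the product of \<^typ>\<open>igraph \<Rightarrow>\<^sub>0 rat\<close> below is the linear extension of disjoint union.\<close>
instantiation igraph :: comm_monoid_add
begin

lift_definition zero_igraph :: igraph is "({}, {}) :: nat ugraph"
  by (simp add: fin_graph_def graph_iso_refl)

lift_definition plus_igraph :: "igraph \<Rightarrow> igraph \<Rightarrow> igraph" is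
  "\<lambda>G H. relabel sum_encode (disj_union G H)"
proof -
  fix G G' H H' :: "nat ugraph"
  let ?s = "relabel sum_encode :: (nat + nat) ugraph \<Rightarrow> nat ugraph"
  assume G: "fin_graph G \<and> fin_graph G' \<and> G \<cong>\<^sub>g G'" and H: "fin_graph H \<and> fin_graph H' \<and> H \<cong>\<^sub>g H'"
  then have fin: "fin_graph (disj_union G H)" "fin_graph (disj_union G' H')"
    by (simp_all add: fin_graph_disj_union)
  have "?s (disj_union G H) \<cong>\<^sub>g disj_union G H" by (rule sum_encode_copy(3)[OF fin(1)])
  also have "disj_union G H \<cong>\<^sub>g disj_union G' H'" using G H by (simp add: disj_union_cong)
  also have "disj_union G' H' \<cong>\<^sub>g ?s (disj_union G' H')" by (rule sum_encode_copy(2)[OF fin(2)])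
  finally show "fin_graph (?s (disj_union G H)) \<and> fin_graph (?s (disj_union G' H')) \<and>
      ?s (disj_union G H) \<cong>\<^sub>g ?s (disj_union G' H')"
    using sum_encode_copy(1) fin by blast
qed

instance
proof
  note enc = sum_encode_copy
  note fin = fin_graph_disj_union sum_encode_copy(1)
  fix a b c :: igraph
  show "a + b + c = a + (b + c)"
  proof (transfer, clarify)
    fix G H K :: "nat ugraph"
    assume 1: "fin_graph G" "fin_graph H" "fin_graph K"
    let ?s = "relabel sum_encode :: (nat + nat) ugraph \<Rightarrow> nat ugraph"
    have "?s (disj_union (?s (disj_union G H)) K) \<cong>\<^sub>g disj_union (?s (disj_union G H)) K"
      using 1 by (intro enc fin)
    also have "disj_union (?s (disj_union G H)) K \<cong>\<^sub>g disj_union (disj_union G H) K"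
      using 1 by (intro disj_union_cong enc fin graph_iso_refl)
    also have "disj_union (disj_union G H) K \<cong>\<^sub>g disj_union G (disj_union H K)"
      by (rule disj_union_assoc)
    also have "disj_union G (disj_union H K) \<cong>\<^sub>g disj_union G (?s (disj_union H K))"
      using 1 by (intro disj_union_cong enc fin graph_iso_refl)
    also have "disj_union G (?s (disj_union H K)) \<cong>\<^sub>g ?s (disj_union G (?s (disj_union H K)))"
      using 1 by (intro enc fin)
    finally
    show "fin_graph (?s (disj_union (?s (disj_union G H)) K)) \<and>
      fin_graph (?s (disj_union G (?s (disj_union H K)))) \<and>
      ?s (disj_union (?s (disj_union G H)) K) \<cong>\<^sub>g ?s (disj_union G (?s (disj_union H K)))"
      using 1 by (auto intro!: fin)
  qed
  show "a + b = b + a"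
  proof (transfer, clarify)
    fix G H :: "nat ugraph"
    assume 1: "fin_graph G" "fin_graph H"
    let ?s = "relabel sum_encode :: (nat + nat) ugraph \<Rightarrow> nat ugraph"
    have "?s (disj_union G H) \<cong>\<^sub>g disj_union G H" using 1 by (intro enc fin)
    also have "disj_union G H \<cong>\<^sub>g disj_union H G" by (rule disj_union_comm)
    also have "disj_union H G \<cong>\<^sub>g ?s (disj_union H G)" using 1 by (intro enc fin)
    finally show "fin_graph (?s (disj_union G H)) \<and> fin_graph (?s (disj_union H G)) \<and>
      ?s (disj_union G H) \<cong>\<^sub>g ?s (disj_union H G)"
      using 1 by (auto intro!: fin)
  qed
  show "0 + a = a"
  proof (induction a rule: igraph.abs_induct)
    case (1 G)
    then have G: "fin_graph G" by simp
    have 0: "fin_graph (({}, {}) :: nat ugraph)" by (simp add: fin_graph_def)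
    let ?U = "disj_union (({}, {}) :: nat ugraph) G"
    have U: "fin_graph ?U" by (rule fin_graph_disj_union[OF 0 G])
    have "relabel sum_encode ?U \<cong>\<^sub>g ?U" by (rule enc(3)[OF U])
    also have "?U \<cong>\<^sub>g G" by (rule graph_iso_sym[OF G disj_union_empty])
    finally have "abs_igraph (relabel sum_encode ?U) = abs_igraph G"
      by (rule abs_igraph_eq_iff[OF enc(1)[OF U] G, THEN iffD2])
    then show ?case
      using 0 G by (simp add: zero_igraph_def plus_igraph.abs_eq graph_iso_refl)
  qed
qed

end

definition lambda_chr_graph :: "'a ugraph \<Rightarrow> rat" where
  "lambda_chr_graph G = (\<Prod>C\<in>components G. poly (pderiv (chrom_poly (induced G C))) 0)"

definition delta_graph :: "'a ugraph \<Rightarrow> (igraph \<times> igraph) \<Rightarrow>\<^sub>0 rat" where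
  "delta_graph G =
     (\<Sum>r | r \<triangleleft> G. Poly_Mapping.single (iclass (quot_graph G r), iclass (restr_graph G r)) 1)"

lemma lambda_chr_graph_relabel:
  assumes "fin_graph G" "inj_on f (verts G)"
  shows "lambda_chr_graph (relabel f G) = lambda_chr_graph G"
proof -
  have "inj_on (image f) (components G)"
    using inj_on_image_eq_iff[OF assms(2) component_subset component_subset]
    by (auto intro!: inj_onI)
  moreover have "chrom_poly (induced (relabel f G) (f ` C)) = chrom_poly (induced G C)"
    if "C \<in> components G" for C
  proof -
    have C: "C \<subseteq> verts G" by (rule component_subset[OF that])
    then have "inj_on f (verts (induced G C))"
      using assms(2) by (simp add: induced_def inj_on_subset)
    then show ?thesis
      using assms C by (simp add: relabel_induced chrom_poly_relabel fin_graph_induced)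
  qed
  ultimately show ?thesis
    by (simp add: lambda_chr_graph_def components_relabel[OF assms] prod.reindex)
qed

lemma delta_graph_relabel:
  assumes "fin_graph G" "inj_on f (verts G)"
  shows "delta_graph (relabel f G) = delta_graph G"
proof -
  have 1: "iclass (quot_graph (relabel f G) (map_prod f f ` r)) = iclass (quot_graph G r)"
    if "r \<triangleleft> G" for r
  proof -
    have r: "equiv (verts G) r" using that by (simp add: admissible_def)
    have "inj_on (image f) (verts (quot_graph G r))"
    proof (rule inj_onI)
      fix C D assume "C \<in> verts (quot_graph G r)" "D \<in> verts (quot_graph G r)" "f ` C = f ` D"
      moreover from this have "C \<subseteq> verts G" "D \<subseteq> verts G"
        using r by (auto simp: quot_graph_def quotient_def equiv_def)
      ultimately show "C = D" using inj_on_image_eq_iff[OF assms(2)] by blast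
    qed
    then show ?thesis
      using r assms by (simp add: quot_graph_relabel iclass_relabel fin_graph_quot_graph)
  qed
  have 2: "iclass (restr_graph (relabel f G) (map_prod f f ` r)) = iclass (restr_graph G r)"
    if "r \<triangleleft> G" for r
  proof -
    have r: "equiv (verts G) r" using that by (simp add: admissible_def)
    have "inj_on f (verts (restr_graph G r))" using assms(2) by (simp add: restr_graph_def)
    then show ?thesis
      using r assms by (simp add: restr_graph_relabel iclass_relabel fin_graph_restr_graph)
  qed
  show ?thesis
    unfolding delta_graph_def
    by (subst sum.reindex_bij_betw[OF bij_betw_admissible[OF assms], symmetric])
      (simp add: 1 2)
qed

lift_definition ivcount :: "igraph \<Rightarrow> nat" is "\<lambda>G. card (verts G)"
  by (auto simp: graph_iso_relabel card_image)

lift_definition iedgeless :: "igraph \<Rightarrow> bool" is "\<lambda>G. edges G = {}"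
  by (auto simp: graph_iso_relabel)

lift_definition ichrom :: "igraph \<Rightarrow> rat poly" is chrom_poly
  by (auto simp: graph_iso_relabel chrom_poly_relabel)

lift_definition ilambda :: "igraph \<Rightarrow> rat" is lambda_chr_graph
  by (auto simp: graph_iso_relabel lambda_chr_graph_relabel)

lift_definition idelta :: "igraph \<Rightarrow> (igraph \<times> igraph) \<Rightarrow>\<^sub>0 rat" is delta_graph
  by (auto simp: graph_iso_relabel delta_graph_relabel)

lemma
  assumes "fin_graph G"
  shows ivcount_iclass: "ivcount (iclass G) = card (verts G)"
    and iedgeless_iclass: "iedgeless (iclass G) \<longleftrightarrow> edges G = {}"
    and ichrom_iclass: "ichrom (iclass G) = chrom_poly G"
    and ilambda_iclass: "ilambda (iclass G) = lambda_chr_graph G"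
    and idelta_iclass: "idelta (iclass G) = delta_graph G"
proof -
  have inj: "inj_on (to_nat_on (verts G)) (verts G)"
    using assms by (intro inj_on_to_nat_on) (auto simp: fin_graph_def countable_finite)
  have fin: "fin_graph (relabel (to_nat_on (verts G)) G) \<and>
      fin_graph (relabel (to_nat_on (verts G)) G) \<and>
      relabel (to_nat_on (verts G)) G \<cong>\<^sub>g relabel (to_nat_on (verts G)) G"
    using nat_copy[OF assms] graph_iso_refl by blast
  show "ivcount (iclass G) = card (verts G)"
    by (simp add: iclass_def ivcount.abs_eq fin card_image inj)
  show "iedgeless (iclass G) \<longleftrightarrow> edges G = {}"
    by (simp add: iclass_def iedgeless.abs_eq fin)
  show "ichrom (iclass G) = chrom_poly G"
    by (simp add: iclass_def ichrom.abs_eq fin chrom_poly_relabel inj assms)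
  show "ilambda (iclass G) = lambda_chr_graph G"
    by (simp add: iclass_def ilambda.abs_eq fin lambda_chr_graph_relabel inj assms)
  show "idelta (iclass G) = delta_graph G"
    by (simp add: iclass_def idelta.abs_eq fin delta_graph_relabel inj assms)
qed


section \<open>The bialgebra of graphs\<close>

text \<open>The unit of this algebra is the empty graph and its product is disjoint union.
  The tensor square is the space with basis the pairs of isomorphism classes.\<close>
type_synonym galg = "igraph \<Rightarrow>\<^sub>0 rat"
type_synonym galg2 = "(igraph \<times> igraph) \<Rightarrow>\<^sub>0 rat"

definition gbasis :: "'a ugraph \<Rightarrow> galg" where
  "gbasis G = Poly_Mapping.single (iclass G) 1"

definition pm_scale :: "rat \<Rightarrow> ('b \<Rightarrow>\<^sub>0 rat) \<Rightarrow> ('b \<Rightarrow>\<^sub>0 rat)" where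
  "pm_scale q = Poly_Mapping.map ((*) q)"

text \<open>Linear extension of a map given on basis elements, with values in a space with scalar
  multiplication \<^term>\<open>s\<close>.\<close>
definition lin_ext :: "(rat \<Rightarrow> 'v \<Rightarrow> 'v) \<Rightarrow> ('b \<Rightarrow> 'v) \<Rightarrow> ('b \<Rightarrow>\<^sub>0 rat) \<Rightarrow> 'v::comm_monoid_add" where
  "lin_ext s f x = (\<Sum>b\<in>Poly_Mapping.keys x. s (Poly_Mapping.lookup x b) (f b))"

definition delta :: "galg \<Rightarrow> galg2" where
  "delta = lin_ext pm_scale idelta"

definition eps' :: "galg \<Rightarrow> rat" where
  "eps' = lin_ext (*) (\<lambda>c. if iedgeless c then 1 else 0)"

definition P_chr :: "galg \<Rightarrow> rat poly" where
  "P_chr = lin_ext smult ichrom"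

definition phi0 :: "galg \<Rightarrow> rat poly" where
  "phi0 = lin_ext smult (\<lambda>c. monom 1 (ivcount c))"

definition lambda_chr :: "galg \<Rightarrow> rat" where
  "lambda_chr = lin_ext (*) ilambda"

text \<open>The map \<open>\<phi> \<otimes> \<mu>\<close> for linear \<open>\<phi>\<close>, \<open>\<mu>\<close>, where \<open>\<mu>\<close> is scalar-valued and \<open>V \<otimes> \<rat>\<close> is identified
  with \<open>V\<close>.\<close>
definition tensor_map ::
    "(rat \<Rightarrow> 'v \<Rightarrow> 'v) \<Rightarrow> (galg \<Rightarrow> 'v) \<Rightarrow> (galg \<Rightarrow> rat) \<Rightarrow> galg2 \<Rightarrow> 'v::comm_monoid_add" where
  "tensor_map s \<phi> \<mu> =
     lin_ext s (\<lambda>(a, b). s (\<mu> (Poly_Mapping.single b 1)) (\<phi> (Poly_Mapping.single a 1)))"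

definition conv :: "(galg \<Rightarrow> rat) \<Rightarrow> (galg \<Rightarrow> rat) \<Rightarrow> galg \<Rightarrow> rat" where
  "conv \<mu> \<nu> = tensor_map (*) \<mu> \<nu> \<circ> delta"

definition char_act :: "(galg \<Rightarrow> rat poly) \<Rightarrow> (galg \<Rightarrow> rat) \<Rightarrow> galg \<Rightarrow> rat poly"
    (infixl \<open>\<leftarrow>\<^sub>c\<close> 70) where
  "\<phi> \<leftarrow>\<^sub>c \<mu> = tensor_map smult \<phi> \<mu> \<circ> delta"

definition characters :: "(galg \<Rightarrow> rat) set" where
  "characters = {\<mu>. Vector_Spaces.linear pm_scale (*) \<mu> \<and> \<mu> 1 = 1 \<and> (\<forall>x y. \<mu> (x * y) = \<mu> x * \<mu> y)}"

definition char_monoid :: "(galg \<Rightarrow> rat) monoid" where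
  "char_monoid = \<lparr>carrier = characters, monoid.mult = conv, one = eps'\<rparr>"


subsection \<open>Values on basis elements\<close>

lemma lookup_pm_scale: "Poly_Mapping.lookup (pm_scale q x) b = q * Poly_Mapping.lookup x b"
  by (simp add: pm_scale_def Poly_Mapping.map.rep_eq when_def)

lemma pm_scale_vector_space: "vector_space (pm_scale :: rat \<Rightarrow> ('b \<Rightarrow>\<^sub>0 rat) \<Rightarrow> ('b \<Rightarrow>\<^sub>0 rat))"
  by unfold_locales (auto intro!: poly_mapping_eqI simp: lookup_pm_scale lookup_add algebra_simps)

lemma pm_scale_one [simp]: "pm_scale 1 x = x"
  by (rule poly_mapping_eqI) (simp add: lookup_pm_scale)

lemma lin_ext_single:
  "(\<And>v. s 1 v = v) \<Longrightarrow> lin_ext s f (Poly_Mapping.single b 1) = f b"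
  by (simp add: lin_ext_def)

lemma
  assumes "fin_graph G"
  shows delta_gbasis: "delta (gbasis G) = delta_graph G"
    and eps'_gbasis: "eps' (gbasis G) = (if edges G = {} then 1 else 0)"
    and P_chr_gbasis: "P_chr (gbasis G) = chrom_poly G"
    and phi0_gbasis: "phi0 (gbasis G) = monom 1 (card (verts G))"
    and lambda_chr_gbasis: "lambda_chr (gbasis G) = lambda_chr_graph G"
  using assms
  by (simp_all add: delta_def eps'_def P_chr_def phi0_def lambda_chr_def gbasis_def lin_ext_single
      ivcount_iclass iedgeless_iclass ichrom_iclass ilambda_iclass idelta_iclass)

lemma lambda_chr_connected:
  assumes "fin_graph G" "gconnected G"
  shows "lambda_chr (gbasis G) = poly (pderiv (P_chr (gbasis G))) 0"
proof -
  have "components G = {verts G}"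
    using assms(2) by (auto simp: components_def gconnected_def quotient_def)
  moreover have "induced G (verts G) = G"
    using fin_graph_edgeD[OF assms(1)] by (auto simp: induced_def prod_eq_iff)
  ultimately show ?thesis
    using assms(1) by (simp add: lambda_chr_gbasis P_chr_gbasis lambda_chr_graph_def)
qed

lemma gbasis_empty: "gbasis (({}, {}) :: 'a ugraph) = 1"
proof -
  have "iclass (({}, {}) :: 'a ugraph) = 0"
    by (simp add: iclass_def relabel_def zero_igraph_def)
  then show ?thesis by (simp add: gbasis_def)
qed

lemma gbasis_disj_union:
  assumes "fin_graph G" "fin_graph H"
  shows "gbasis (disj_union G H) = gbasis G * gbasis H"
proof -
  let ?G = "relabel (to_nat_on (verts G)) G" and ?H = "relabel (to_nat_on (verts H)) H"
  let ?U = "relabel sum_encode (disj_union ?G ?H)"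
  note fin = nat_copy(1)[OF assms(1)] nat_copy(1)[OF assms(2)]
  have dfin: "fin_graph (disj_union ?G ?H)" by (rule fin_graph_disj_union[OF fin])
  have e: "inj_on sum_encode A" for A by (rule inj_on_subset[OF inj_sum_encode subset_UNIV])
  have U: "fin_graph ?U" by (rule fin_graph_relabel[OF dfin e])
  have "iclass G + iclass H = abs_igraph ?U"
    unfolding iclass_def by (rule plus_igraph.abs_eq) (simp_all add: fin graph_iso_refl)
  also have "\<dots> = iclass ?U" by (rule iclass_nat[OF U, symmetric])
  also have "\<dots> = iclass (disj_union ?G ?H)"
    by (rule iclass_relabel[OF dfin e])
  also have "\<dots> = iclass (disj_union G H)"
    by (rule iclass_eq_iff[THEN iffD2, OF dfin fin_graph_disj_union[OF assms]],
        rule disj_union_cong)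
      (rule graph_iso_sym[OF assms(1) nat_copy(2)[OF assms(1)]],
       rule graph_iso_sym[OF assms(2) nat_copy(2)[OF assms(2)]])
  finally show ?thesis by (simp add: gbasis_def mult_single)
qed

end

theory Submission
  imports Defs
begin

text \<open>Everything rests on the subset expansion of the chromatic polynomial
  (\<open>chrom_poly_Pow\<close>): with \<open>c(F)\<close> the number of components of the spanning subgraph with edge
  set \<open>F\<close>, inclusion-exclusion over the monochromatic edges of a map gives
  \<open>P_chr(G) = \<Sum>\<^sub>F (-1)\<^bsup>|F|\<^esup> X\<^bsup>c(F)\<^esup>\<close>, the sum running over all \<open>F \<subseteq> E(G)\<close>.

  Since \<open>P_chr\<close> is multiplicative over components and has no constant term on a connected
  graph, \<open>\<lambda>_chr(G)\<close> is the coefficient of \<open>X\<^bsup>c(G)\<^esup>\<close> in \<open>P_chr(G)\<close>, with \<open>c(G)\<close> the number of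
  components of \<open>G\<close>. By the expansion it is therefore the sum of \<open>(-1)\<^bsup>|F|\<^esup>\<close> over those \<open>F\<close> that have
  the same components as \<open>G\<close> (\<open>lambda_chr_graph_Pow\<close>).

  The relations \<open>r \<triangleleft> G\<close> are exactly the partitions into components of the edge subsets \<open>F\<close>.
  Grouping the expansion by this partition, the terms that belong to \<open>r\<close> are those of
  \<open>\<lambda>_chr(G|r)\<close>, all with the power \<open>X\<^bsup>cl(r)\<^esup>\<close>: this is \<open>P_chr = \<phi>\<^sub>0 \<leftarrow> \<lambda>_chr\<close>
  (\<open>chrom_poly_admissible\<close>). At \<open>X = 1\<close> it becomes \<open>\<Sum>\<^sub>r \<lambda>_chr(G|r) = \<epsilon>'(G)\<close>, because one colour
  suffices only if there are no edges.

  For the sum over quotients, every map \<open>f\<close> from the vertices to \<open>k\<close> colours is a proper colouring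
  of exactly one \<open>G/r\<close>, namely for \<open>r\<close> the components of the monochromatic edges of \<open>f\<close>. Hence
  \<open>\<Sum>\<^sub>r P_chr(G/r) = X\<^bsup>|V(G)|\<^esup>\<close> (\<open>sum_chrom_poly_quot_graph\<close>). All \<open>G/r\<close> have as many components as
  \<open>G\<close>, so comparing the coefficients of \<open>X\<^bsup>c(G)\<^esup>\<close> yields \<open>\<Sum>\<^sub>r \<lambda>_chr(G/r) = \<epsilon>'(G)\<close>.

  The two sums say that the character \<open>\<zeta>\<close> with value 1 on every graph is a left and a right inverse
  of \<open>\<lambda>_chr\<close>. That there is no other inverse follows from the triangularity of \<open>\<delta>\<close>: only
  for the partition of \<open>G\<close> into its components is \<open>G|r = G\<close>, so a right inverse is determined by induction on the number of edges
  (\<open>right_inverse_lambda_chr_unique\<close>).\<close>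

section \<open>Equivalence relations and the functions constant on their classes\<close>

text \<open>The image map \<open>X \<mapsto> p ` X\<close> is a bijection of classes, because \<open>p\<close> preserves and reflects the
  relations.\<close>
lemma card_quotient_surj:
  assumes "equiv A t" "equiv B s" "p ` A = B"
    and st: "\<And>x y. x \<in> A \<Longrightarrow> y \<in> A \<Longrightarrow> (p x, p y) \<in> s \<longleftrightarrow> (x, y) \<in> t"
  shows "card (B // s) = card (A // t)"
proof -
  have im: "p ` (t `` {x}) = s `` {p x}" if "x \<in> A" for x
  proof
    show "p ` (t `` {x}) \<subseteq> s `` {p x}"
      using that st equiv_type[OF assms(1)] by blast
    show "s `` {p x} \<subseteq> p ` (t `` {x})"
    proof
      fix b assume b: "b \<in> s `` {p x}"
      then have "b \<in> B" using equiv_type[OF assms(2)] by blast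
      then obtain y where "y \<in> A" "b = p y" using assms(3) by blast
      then show "b \<in> p ` (t `` {x})" using b st[OF that] by auto
    qed
  qed
  have "inj_on (image p) (A // t)"
  proof (rule inj_onI)
    fix X Y assume "X \<in> A // t" "Y \<in> A // t" and eq: "p ` X = p ` Y"
    then obtain x y where xy: "x \<in> A" "y \<in> A" "X = t `` {x}" "Y = t `` {y}"
      by (auto elim!: quotientE)
    then have "s `` {p x} = s `` {p y}" using eq im by simp
    then have "(p x, p y) \<in> s" using xy assms(2,3) by (metis eq_equiv_class_iff imageI)
    then show "X = Y" using xy st assms(1) by (simp add: eq_equiv_class_iff)
  qed
  moreover have "(image p) ` (A // t) = B // s"
  proof -
    have "(image p) ` (A // t) = (\<lambda>x. p ` (t `` {x})) ` A" by (auto simp: quotient_def)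
    also have "\<dots> = (\<lambda>b. s `` {b}) ` (p ` A)"
      unfolding image_image by (rule image_cong) (simp_all add: im)
    also have "\<dots> = B // s" by (auto simp: quotient_def assms(3))
    finally show ?thesis .
  qed
  ultimately show ?thesis by (metis card_image)
qed

text \<open>Sending a class of \<open>r\<close> to the class of \<open>s\<close> that contains it is a surjection between sets of
  equal finite size, hence injective. It identifies a coefficient condition on numbers of components
  with an equality of partitions.\<close>
lemma refinement_eq_if_card_eq:
  assumes "finite V" "equiv V r" "equiv V s" "r \<subseteq> s" "card (V // r) = card (V // s)"
  shows "r = s"
proof
  let ?f = "\<lambda>X. s `` X"
  have cls: "s `` (r `` {x}) = s `` {x}" if "x \<in> V" for x
  proof
    have "(x, y) \<in> s" if "(x, z) \<in> r" "(z, y) \<in> s" for y z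
      using that assms(3,4) unfolding equiv_def by (meson subsetD transD)
    then show "s `` (r `` {x}) \<subseteq> s `` {x}" by blast
    have "(x, x) \<in> r" using that assms(2) by (simp add: equiv_def refl_on_def)
    then show "s `` {x} \<subseteq> s `` (r `` {x})" by blast
  qed
  have "?f ` (V // r) = (\<lambda>x. s `` (r `` {x})) ` V" by (auto simp: quotient_def)
  also have "\<dots> = (\<lambda>x. s `` {x}) ` V" by (rule image_cong) (simp_all add: cls)
  also have "\<dots> = V // s" by (auto simp: quotient_def)
  finally have "?f ` (V // r) = V // s" .
  then have inj: "inj_on ?f (V // r)"
    using assms(1,5) by (intro eq_card_imp_inj_on) (auto simp: quotient_def)
  show "s \<subseteq> r"
  proof clarify
    fix x y assume xy: "(x, y) \<in> s"
    then have V: "x \<in> V" "y \<in> V" using equiv_type[OF assms(3)] by blast+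
    then have "s `` (r `` {x}) = s `` (r `` {y})"
      using xy cls assms(3) by (simp add: eq_equiv_class_iff)
    then have "r `` {x} = r `` {y}" by (rule inj_onD[OF inj]) (simp_all add: V quotientI)
    then show "(x, y) \<in> r" using V assms(2) by (simp add: eq_equiv_class_iff)
  qed
qed (rule assms)

text \<open>The pullback along the projection from \<open>V\<close> to its set of classes.\<close>
definition lift_fun :: "'a set \<Rightarrow> ('a \<times> 'a) set \<Rightarrow> ('a set \<Rightarrow> 'b) \<Rightarrow> 'a \<Rightarrow> 'b" where
  "lift_fun V r g = (\<lambda>x\<in>V. g (r `` {x}))"

lemma bij_betw_lift_fun:
  assumes r: "equiv V r"
  shows "bij_betw (lift_fun V r) (V // r \<rightarrow>\<^sub>E S) {f \<in> V \<rightarrow>\<^sub>E S. \<forall>(x, y)\<in>r. f x = f y}"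
proof (rule bij_betw_byWitness[where f' = "\<lambda>f. \<lambda>C\<in>V // r. f (SOME x. x \<in> C)"])
  have V: "x \<in> V" "y \<in> V" if "(x, y) \<in> r" for x y using that r by (auto simp: equiv_def)
  have some: "(x, SOME y. (x, y) \<in> r) \<in> r" if "x \<in> V" for x
    using that r by (intro someI[of "\<lambda>y. (x, y) \<in> r" x]) (auto simp: equiv_def refl_on_def)
  have some_class: "r `` {SOME y. (x, y) \<in> r} = r `` {x}" if "x \<in> V" for x
    using some[OF that] V eq_equiv_class_iff[OF r] by metis
  show "\<forall>g\<in>V // r \<rightarrow>\<^sub>E S. (\<lambda>C\<in>V // r. lift_fun V r g (SOME x. x \<in> C)) = g"
  proof (intro ballI ext)
    fix g C assume g: "g \<in> V // r \<rightarrow>\<^sub>E S"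
    show "(\<lambda>C\<in>V // r. lift_fun V r g (SOME x. x \<in> C)) C = g C"
    proof (cases "C \<in> V // r")
      case True
      then obtain x where "x \<in> V" "C = r `` {x}" by (auto elim: quotientE)
      then show ?thesis using True some_class[of x] V(2)[OF some[of x]] by (simp add: lift_fun_def)
    next
      case False
      then show ?thesis using g by (auto simp: PiE_def extensional_def)
    qed
  qed
  show "\<forall>f\<in>{f \<in> V \<rightarrow>\<^sub>E S. \<forall>(x, y)\<in>r. f x = f y}.
      lift_fun V r (\<lambda>C\<in>V // r. f (SOME x. x \<in> C)) = f"
  proof (intro ballI ext)
    fix f x assume f: "f \<in> {f \<in> V \<rightarrow>\<^sub>E S. \<forall>(x, y)\<in>r. f x = f y}"
    show "lift_fun V r (\<lambda>C\<in>V // r. f (SOME x. x \<in> C)) x = f x"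
    proof (cases "x \<in> V")
      case True
      then have "f x = f (SOME y. (x, y) \<in> r)" using f some[of x] by blast
      then show ?thesis using True by (simp add: lift_fun_def quotientI)
    next
      case False
      then show ?thesis using f by (auto simp: lift_fun_def PiE_def extensional_def)
    qed
  qed
  show "lift_fun V r ` (V // r \<rightarrow>\<^sub>E S) \<subseteq> {f \<in> V \<rightarrow>\<^sub>E S. \<forall>(x, y)\<in>r. f x = f y}"
  proof (rule image_subsetI)
    fix g assume g: "g \<in> V // r \<rightarrow>\<^sub>E S"
    have "lift_fun V r g x = lift_fun V r g y" if "(x, y) \<in> r" for x y
      using that V[OF that] eq_equiv_class_iff[OF r, of x y] by (simp add: lift_fun_def)
    moreover have "lift_fun V r g \<in> V \<rightarrow>\<^sub>E S"
      using g by (auto simp: lift_fun_def quotientI intro!: PiE_mem[OF g])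
    ultimately show "lift_fun V r g \<in> {f \<in> V \<rightarrow>\<^sub>E S. \<forall>(x, y)\<in>r. f x = f y}" by blast
  qed
  show "(\<lambda>f. \<lambda>C\<in>V // r. f (SOME x. x \<in> C)) ` {f \<in> V \<rightarrow>\<^sub>E S. \<forall>(x, y)\<in>r. f x = f y}
      \<subseteq> V // r \<rightarrow>\<^sub>E S"
  proof (rule image_subsetI)
    fix f assume f: "f \<in> {f \<in> V \<rightarrow>\<^sub>E S. \<forall>(x, y)\<in>r. f x = f y}"
    have "f (SOME x. x \<in> C) \<in> S" if "C \<in> V // r" for C
    proof -
      obtain x where "x \<in> V" "C = r `` {x}" using \<open>C \<in> V // r\<close> by (rule quotientE)
      then show ?thesis using f V(2)[OF some[of x]] by auto
    qed
    then show "(\<lambda>C\<in>V // r. f (SOME x. x \<in> C)) \<in> V // r \<rightarrow>\<^sub>E S" by simp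
  qed
qed

text \<open>Such a map is a free choice of a value for each class.\<close>
lemma card_constant_on_classes:
  assumes "finite V" "equiv V r"
  shows "card {f \<in> V \<rightarrow>\<^sub>E S. \<forall>(x, y)\<in>r. f x = f y} = card S ^ card (V // r)"
proof -
  have "finite (V // r)" using assms(1) by (auto simp: quotient_def)
  then have "card (V // r \<rightarrow>\<^sub>E S) = card S ^ card (V // r)" by (simp add: card_PiE)
  then show ?thesis using bij_betw_same_card[OF bij_betw_lift_fun[OF assms(2), of S]] by simp
qed


section \<open>The partition into components of a set of edges\<close>

definition conn :: "'a set \<Rightarrow> 'a set set \<Rightarrow> ('a \<times> 'a) set" where
  "conn V F = {(x, y) \<in> V \<times> V. (x, y) \<in> (adj_rel (V, F))\<^sup>*}"

lemma components_eq: "components G = verts G // conn (verts G) (edges G)"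
  by (simp add: components_def conn_def adj_rel_def)

lemma equiv_conn: "equiv V (conn V F)"
proof (rule equivI)
  have "sym ((adj_rel (V, F))\<^sup>*)"
    by (rule sym_rtrancl) (auto simp: sym_def adj_rel_def insert_commute)
  then show "sym (conn V F)" by (auto simp: conn_def sym_def)
qed (auto simp: conn_def refl_on_def trans_def)

lemma conn_sym: "(x, y) \<in> conn V F \<Longrightarrow> (y, x) \<in> conn V F"
  using equiv_conn[of V F] by (simp add: equiv_def symD)

lemma conn_trans: "(x, y) \<in> conn V F \<Longrightarrow> (y, z) \<in> conn V F \<Longrightarrow> (x, z) \<in> conn V F"
  using equiv_conn[of V F] unfolding equiv_def by (meson transD)

lemma conn_edge: "x \<in> V \<Longrightarrow> y \<in> V \<Longrightarrow> {x, y} \<in> F \<Longrightarrow> (x, y) \<in> conn V F"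
  by (auto simp: conn_def adj_rel_def)

text \<open>The universal property of the partition into components: it is the finest equivalence
  relation that joins the ends of every edge.\<close>
lemma conn_subset_iff:
  assumes "equiv V r" "\<And>x y. {x, y} \<in> F \<Longrightarrow> x \<in> V \<and> y \<in> V"
  shows "conn V F \<subseteq> r \<longleftrightarrow> (\<forall>x y. {x, y} \<in> F \<longrightarrow> (x, y) \<in> r)"
proof
  assume "conn V F \<subseteq> r"
  then show "\<forall>x y. {x, y} \<in> F \<longrightarrow> (x, y) \<in> r" using assms(2) conn_edge by (metis subsetD)
next
  assume F: "\<forall>x y. {x, y} \<in> F \<longrightarrow> (x, y) \<in> r"
  have "(x, y) \<in> r" if "(x, y) \<in> (adj_rel (V, F))\<^sup>*" "x \<in> V" for x y
    using that
  proof (induction rule: rtrancl_induct)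
    case base
    then show ?case using assms(1) by (auto simp: equiv_def refl_on_def)
  next
    case (step y z)
    then show ?case using F assms(1) by (auto simp: adj_rel_def equiv_def dest: transD)
  qed
  then show "conn V F \<subseteq> r" by (auto simp: conn_def)
qed

lemma conn_empty: "conn V {} = Id_on V"
  by (auto simp: conn_def adj_rel_def)

lemma conn_mono:
  assumes "F \<subseteq> F'"
  shows "conn V F \<subseteq> conn V F'"
proof -
  have "adj_rel (V, F) \<subseteq> adj_rel (V, F')" using assms by (auto simp: adj_rel_def)
  then have "(adj_rel (V, F))\<^sup>* \<subseteq> (adj_rel (V, F'))\<^sup>*" by (rule rtrancl_mono)
  then show ?thesis unfolding conn_def by blast
qed

lemma finite_edges: "fin_graph G \<Longrightarrow> finite (edges G)"
  by (rule finite_subset[of _ "Pow (verts G)"]) (auto simp: fin_graph_def)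

lemma edge_verts: "fin_graph G \<Longrightarrow> {x, y} \<in> edges G \<Longrightarrow> x \<in> verts G \<and> y \<in> verts G"
  by (auto simp: fin_graph_def)

lemma edge_pair:
  assumes "fin_graph G" "e \<in> edges G"
  obtains x y where "e = {x, y}" "x \<noteq> y"
  using assms by (auto simp: fin_graph_def card_2_iff)

lemma finite_components: "fin_graph G \<Longrightarrow> finite (components G)"
  by (auto simp: components_eq quotient_def fin_graph_def)

text \<open>A path whose edges lie in \<open>F\<close> never leaves its \<open>F\<close>-component, so it is also a path in the
  subgraph of \<open>G\<close> induced on that component.\<close>
lemma admissible_conn:
  assumes G: "fin_graph G" and F: "F \<subseteq> edges G"
  shows "conn (verts G) F \<triangleleft> G"
  unfolding admissible_def
proof (intro conjI ballI equiv_conn)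
  let ?V = "verts G" and ?r = "conn (verts G) F"
  fix C assume "C \<in> ?V // ?r"
  then obtain a where a: "a \<in> ?V" "C = ?r `` {a}" by (auto elim: quotientE)
  have path: "(x, y) \<in> (adj_rel (induced G C))\<^sup>*"
    if "(x, y) \<in> (adj_rel (?V, F))\<^sup>*" "x \<in> C" for x y
    using that
  proof (induction rule: rtrancl_induct)
    case (step y z)
    have yz: "{y, z} \<in> F" using step by (simp add: adj_rel_def)
    have "x \<in> ?V" using step a by (auto simp: conn_def)
    then have x: "(a, x) \<in> ?r" using step(4) a(2) by auto
    have V: "y \<in> ?V" "z \<in> ?V" using yz F edge_verts[OF G] by blast+
    have "(x, y) \<in> ?r" "(x, z) \<in> ?r"
      using step(1,2) V \<open>x \<in> ?V\<close> by (auto simp: conn_def)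
    then have "y \<in> C" "z \<in> C" using x a(2) equiv_conn[of ?V F] by (auto simp: equiv_def dest: transD)
    then have "(y, z) \<in> adj_rel (induced G C)"
      using yz F by (auto simp: adj_rel_def induced_def)
    then show ?case using step by (meson rtrancl.rtrancl_into_rtrancl)
  qed simp
  have "(x, y) \<in> ?r" if "x \<in> C" "y \<in> C" for x y
    using that a(2) equiv_conn[of ?V F] unfolding equiv_def by (meson Image_singleton_iff symD transD)
  then have "(x, y) \<in> (adj_rel (induced G C))\<^sup>*" if "x \<in> C" "y \<in> C" for x y
    using path that by (auto simp: conn_def)
  moreover have "C \<noteq> {}" using a equiv_conn[of ?V F] by (auto simp: equiv_def refl_on_def)
  ultimately show "gconnected (induced G C)"
    by (auto simp: gconnected_def) (auto simp: induced_def)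
qed

lemma edges_restr_graph: "edges (restr_graph G r) = {{x, y} | x y. {x, y} \<in> edges G \<and> (x, y) \<in> r}"
  by (simp add: restr_graph_def)

lemma edge_restr_graph_iff:
  assumes "equiv V r"
  shows "{x, y} \<in> edges (restr_graph G r) \<longleftrightarrow> {x, y} \<in> edges G \<and> (x, y) \<in> r"
  using assms by (auto simp: edges_restr_graph doubleton_eq_iff insert_commute equiv_def dest: symD)

text \<open>Each class of \<open>r\<close> is connected by edges inside the class, which survive in \<open>G|r\<close>; all other
  edges have been deleted.\<close>
lemma conn_restr_graph:
  assumes G: "fin_graph G" and r: "r \<triangleleft> G"
  shows "conn (verts G) (edges (restr_graph G r)) = r"
proof
  let ?V = "verts G" and ?F = "edges (restr_graph G r)"
  have eq: "equiv ?V r" using r by (simp add: admissible_def)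
  note e = edge_restr_graph_iff[OF eq, of _ _ G]
  show "conn ?V ?F \<subseteq> r"
    using conn_subset_iff[OF eq, of ?F] e edge_verts[OF G] by meson
  show "r \<subseteq> conn ?V ?F"
  proof clarify
    fix x y assume xy: "(x, y) \<in> r"
    then have V: "x \<in> ?V" "y \<in> ?V" using eq by (auto simp: equiv_def)
    let ?C = "r `` {x}"
    have "?C \<in> ?V // r" using V(1) by (rule quotientI)
    then have "gconnected (induced G ?C)" using r by (simp add: admissible_def)
    moreover have "x \<in> ?C" "y \<in> ?C" using xy V eq by (auto simp: equiv_def refl_on_def)
    ultimately have "(x, y) \<in> (adj_rel (induced G ?C))\<^sup>*"
      by (simp add: gconnected_def) (simp add: induced_def)
    moreover have "adj_rel (induced G ?C) \<subseteq> adj_rel (?V, ?F)"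
    proof clarify
      fix u v assume "(u, v) \<in> adj_rel (induced G ?C)"
      then have uv: "{u, v} \<in> edges G" "(x, u) \<in> r" "(x, v) \<in> r" by (auto simp: adj_rel_def induced_def)
      then have "(u, v) \<in> r" using eq by (auto simp: equiv_def dest: symD transD)
      then show "(u, v) \<in> adj_rel (?V, ?F)" using e uv by (simp add: adj_rel_def)
    qed
    ultimately have "(x, y) \<in> (adj_rel (?V, ?F))\<^sup>*" using rtrancl_mono by blast
    then show "(x, y) \<in> conn ?V ?F" using V by (simp add: conn_def)
  qed
qed

lemma edges_restr_graph_subset: "edges (restr_graph G r) \<subseteq> edges G"
  by (auto simp: edges_restr_graph)

lemma admissible_eq_image_conn:
  assumes "fin_graph G"
  shows "{r. r \<triangleleft> G} = conn (verts G) ` Pow (edges G)"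
proof
  show "{r. r \<triangleleft> G} \<subseteq> conn (verts G) ` Pow (edges G)"
  proof
    fix r assume "r \<in> {r. r \<triangleleft> G}"
    then have "r = conn (verts G) (edges (restr_graph G r))"
      using conn_restr_graph[OF assms] by simp
    then show "r \<in> conn (verts G) ` Pow (edges G)"
      by (rule image_eqI) (simp add: edges_restr_graph_subset)
  qed
qed (use admissible_conn[OF assms] in auto)

lemma finite_admissible: "fin_graph G \<Longrightarrow> finite {r. r \<triangleleft> G}"
  by (simp add: admissible_eq_image_conn finite_edges)

text \<open>There are as many components as vertices when every component is a singleton, which leaves no
  room for an edge, as edges are not loops.\<close>
lemma card_components_eq_card_verts_iff:
  assumes G: "fin_graph G"
  shows "card (components G) = card (verts G) \<longleftrightarrow> edges G = {}"
proof
  have V: "finite (verts G)" using G by (simp add: fin_graph_def)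
  have sing: "card (verts G // Id_on (verts G)) = card (verts G)"
  proof -
    have "verts G // Id_on (verts G) = (\<lambda>x. {x}) ` verts G" by (auto simp: quotient_def)
    then show ?thesis by (simp add: card_image)
  qed
  show "card (components G) = card (verts G)" if "edges G = {}"
    using that sing by (simp add: components_eq conn_empty)
  assume "card (components G) = card (verts G)"
  then have "Id_on (verts G) = conn (verts G) (edges G)"
    using V sing equiv_conn[of "verts G" "{}"] equiv_conn[of "verts G" "edges G"]
      conn_mono[of "{}" "edges G" "verts G"]
    by (intro refinement_eq_if_card_eq) (auto simp: components_eq conn_empty)
  then have loop: "x = y" if "{x, y} \<in> edges G" for x y
    using that conn_edge edge_verts[OF G that] by (metis Id_onE prod.inject)
  show "edges G = {}"
  proof (rule equals0I)
    fix e assume e: "e \<in> edges G"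
    then obtain x y where "e = {x, y}" "x \<noteq> y" by (rule edge_pair[OF G])
    then show False using loop e by simp
  qed
qed

lemma edge_quot_graphI:
  assumes G: "fin_graph G" and r: "equiv (verts G) r"
    and xy: "{x, y} \<in> edges G" and ne: "r `` {x} \<noteq> r `` {y}"
  shows "{r `` {x}, r `` {y}} \<in> edges (quot_graph G r)"
proof -
  have V: "x \<in> verts G" "y \<in> verts G" using edge_verts[OF G xy] by auto
  then have cls: "r `` {x} \<in> verts G // r" "r `` {y} \<in> verts G // r" by (simp_all add: quotientI)
  have self: "x \<in> r `` {x}" "y \<in> r `` {y}" using V r by (auto simp: equiv_def refl_on_def)
  show ?thesis
    unfolding quot_graph_def snd_conv
    by (intro CollectI exI[of _ "r `` {x}"] exI[of _ "r `` {y}"] conjI refl cls ne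
        bexI[of _ x] bexI[of _ y] self xy)
qed

text \<open>The edge \<open>{C, D}\<close> is an unordered pair, but its witness can always be oriented from \<open>C\<close> to
  \<open>D\<close>.\<close>
lemma edge_quot_graphE:
  assumes r: "equiv (verts G) r" and CD: "{C, D} \<in> edges (quot_graph G r)"
  obtains u v where "{u, v} \<in> edges G" "u \<in> verts G" "v \<in> verts G"
    "C = r `` {u}" "D = r `` {v}" "r `` {u} \<noteq> r `` {v}"
proof -
  obtain C' D' where *: "{C, D} = {C', D'}" "C' \<in> verts G // r" "D' \<in> verts G // r" "C' \<noteq> D'"
    "\<exists>u\<in>C'. \<exists>v\<in>D'. {u, v} \<in> edges G" using CD by (auto simp: quot_graph_def)
  obtain u' v' where uv': "u' \<in> C'" "v' \<in> D'" "{u', v'} \<in> edges G" "{v', u'} \<in> edges G"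
    using *(5) by (auto simp: insert_commute)
  consider "C = C'" "D = D'" | "C = D'" "D = C'" using *(1) by (auto simp: doubleton_eq_iff)
  then obtain u v where uv: "u \<in> C" "v \<in> D" "{u, v} \<in> edges G" by cases (use uv' in blast)+
  have cls: "C \<in> verts G // r" "D \<in> verts G // r" "C \<noteq> D" using * by (auto simp: doubleton_eq_iff)
  have "X = r `` {z} \<and> z \<in> verts G" if "X \<in> verts G // r" "z \<in> X" for X z
    using that r by (metis Union_quotient UnionI Image_singleton_iff equiv_class_eq quotientE)
  then show ?thesis using that uv cls by metis
qed

text \<open>Two vertices are joined by a path in \<open>G\<close> if and only if their classes are joined by one in
  \<open>G/r\<close>: a step from class to class lifts because every class is itself connected.\<close>
lemma card_components_quot_graph:
  assumes G: "fin_graph G" and r: "r \<triangleleft> G"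
  shows "card (components (quot_graph G r)) = card (components G)"
  unfolding components_eq
proof (rule card_quotient_surj[where p = "\<lambda>x. r `` {x}"])
  let ?V = "verts G" and ?Q = "quot_graph G r"
  let ?t = "conn ?V (edges G)" and ?s = "conn (verts ?Q) (edges ?Q)"
  have eq: "equiv ?V r" using r by (simp add: admissible_def)
  have VQ: "verts ?Q = ?V // r" by (simp add: quot_graph_def)
  show "equiv ?V ?t" "equiv (verts ?Q) ?s" by (rule equiv_conn)+
  show im: "(\<lambda>x. r `` {x}) ` ?V = verts ?Q" by (auto simp: VQ quotient_def)
  have r_sub: "r \<subseteq> ?t"
    using conn_restr_graph[OF G r] conn_mono[OF edges_restr_graph_subset, of ?V G r] by simp
  fix x y assume xy: "x \<in> ?V" "y \<in> ?V"
  show "(r `` {x}, r `` {y}) \<in> ?s \<longleftrightarrow> (x, y) \<in> ?t"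
  proof
    have "D \<in> verts ?Q \<and> (\<forall>z\<in>D. (x, z) \<in> ?t)" if "(r `` {x}, D) \<in> (adj_rel ?Q)\<^sup>*" for D
      using that
    proof (induction rule: rtrancl_induct)
      case base
      then show ?case using xy im r_sub by auto
    next
      case (step C D)
      then have "{C, D} \<in> edges ?Q" by (simp add: adj_rel_def)
      then obtain u v where uv: "{u, v} \<in> edges G" "u \<in> ?V" "v \<in> ?V" "C = r `` {u}" "D = r `` {v}"
        by (rule edge_quot_graphE[OF eq])
      have "u \<in> C" using uv(2,4) eq by (auto simp: equiv_def refl_on_def)
      then have "(x, u) \<in> ?t" using step.IH by simp
      moreover have "(u, v) \<in> ?t" using uv by (simp add: conn_edge)
      ultimately have xv: "(x, v) \<in> ?t" by (rule conn_trans)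
      have "(x, z) \<in> ?t" if "z \<in> D" for z
        using that uv(5) r_sub xv conn_trans[of x v] by (simp add: subset_iff)
      then show ?case using uv(3,5) VQ by (simp add: quotientI)
    qed
    moreover assume "(r `` {x}, r `` {y}) \<in> ?s"
    ultimately show "(x, y) \<in> ?t"
      using xy eq by (auto simp: conn_def adj_rel_def equiv_def refl_on_def)
  next
    let ?R = "{(x, y) \<in> ?V \<times> ?V. (r `` {x}, r `` {y}) \<in> ?s}"
    have e: "equiv ?V ?R"
    proof (rule equivI)
      have "r `` {x} \<in> verts ?Q" if "x \<in> ?V" for x using that VQ by (simp add: quotientI)
      then show "refl_on ?V ?R" by (simp add: refl_on_def conn_def)
      show "sym ?R" by (rule symI) (simp add: conn_sym)
      show "trans ?R"
        by (rule transI) (simp, metis conn_trans)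
    qed (simp add: subset_iff)
    have step: "(x, y) \<in> ?R" if xy: "{x, y} \<in> edges G" for x y
    proof -
      have V: "x \<in> ?V" "y \<in> ?V" using edge_verts[OF G xy] by auto
      have cls: "r `` {x} \<in> ?V // r" "r `` {y} \<in> ?V // r" using V by (simp_all add: quotientI)
      have "(r `` {x}, r `` {y}) \<in> ?s"
      proof (cases "r `` {x} = r `` {y}")
        case True
        then show ?thesis using cls VQ by (simp add: conn_def)
      next
        case False
        have "{r `` {x}, r `` {y}} \<in> edges ?Q" by (rule edge_quot_graphI[OF G eq xy False])
        then show ?thesis using cls VQ by (simp add: conn_edge)
      qed
      then show ?thesis using V by simp
    qed
    have "?t \<subseteq> ?R"
      by (rule conn_subset_iff[OF e, THEN iffD2, OF edge_verts[OF G]]) (assumption, iprover intro: step)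
    moreover assume "(x, y) \<in> ?t"
    ultimately have "(x, y) \<in> ?R" by (rule subsetD)
    then show "(r `` {x}, r `` {y}) \<in> ?s" by simp
  qed
qed


section \<open>The subset expansion of the chromatic polynomial\<close>

definition mono_edges :: "'a ugraph \<Rightarrow> ('a \<Rightarrow> 'b) \<Rightarrow> 'a set set" where
  "mono_edges G f = {e \<in> edges G. \<forall>x\<in>e. \<forall>y\<in>e. f x = f y}"

lemma edge_mono_edges_iff: "{x, y} \<in> mono_edges G f \<longleftrightarrow> {x, y} \<in> edges G \<and> f x = f y"
  by (auto simp: mono_edges_def)

lemma mono_edges_subset: "mono_edges G f \<subseteq> edges G"
  by (auto simp: mono_edges_def)

lemma colouringsI:
  "f \<in> verts G \<rightarrow>\<^sub>E {1..k} \<Longrightarrow> (\<And>x y. {x, y} \<in> edges G \<Longrightarrow> f x \<noteq> f y) \<Longrightarrow> f \<in> colourings G k"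
  unfolding colourings_def by blast

lemma colouringsD:
  assumes "f \<in> colourings G k"
  shows "f \<in> verts G \<rightarrow>\<^sub>E {1..k}" "{x, y} \<in> edges G \<Longrightarrow> f x \<noteq> f y"
proof -
  have "f \<in> verts G \<rightarrow>\<^sub>E {1..k} \<and> (\<forall>x y. {x, y} \<in> edges G \<longrightarrow> f x \<noteq> f y)"
    using assms unfolding colourings_def by (rule CollectD)
  then show "f \<in> verts G \<rightarrow>\<^sub>E {1..k}" and "{x, y} \<in> edges G \<Longrightarrow> f x \<noteq> f y"
    by iprover+
qed

lemma colourings_eq:
  assumes G: "fin_graph G"
  shows "colourings G k = {f \<in> verts G \<rightarrow>\<^sub>E {1..k}. mono_edges G f = {}}"
proof -
  have "(\<forall>x y. {x, y} \<in> edges G \<longrightarrow> f x \<noteq> f y) \<longleftrightarrow> mono_edges G f = {}" for f :: "_ \<Rightarrow> nat"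
  proof
    assume proper: "\<forall>x y. {x, y} \<in> edges G \<longrightarrow> f x \<noteq> f y"
    show "mono_edges G f = {}"
    proof (rule equals0I)
      fix e assume e: "e \<in> mono_edges G f"
      then have "e \<in> edges G" using mono_edges_subset by blast
      then obtain x y where "e = {x, y}" by (rule edge_pair[OF G])
      then show False using e proper edge_mono_edges_iff by metis
    qed
  next
    assume "mono_edges G f = {}"
    then show "\<forall>x y. {x, y} \<in> edges G \<longrightarrow> f x \<noteq> f y"
      by (metis edge_mono_edges_iff empty_iff)
  qed
  then show ?thesis by (simp add: colourings_def)
qed

text \<open>Having the same colour is an equivalence relation, so it joins the ends of all edges in \<open>F\<close>
  as soon as it contains the partition into \<open>F\<close>-components.\<close>
lemma subset_mono_edges_iff:
  assumes G: "fin_graph G" and F: "F \<subseteq> edges G"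
  shows "F \<subseteq> mono_edges G f \<longleftrightarrow> (\<forall>(x, y)\<in>conn (verts G) F. f x = f y)"
proof -
  let ?R = "{(x, y). x \<in> verts G \<and> y \<in> verts G \<and> f x = f y}"
  have "equiv (verts G) ?R"
    by (rule equivI) (auto simp: refl_on_def sym_def trans_def)
  then have "conn (verts G) F \<subseteq> ?R \<longleftrightarrow> (\<forall>x y. {x, y} \<in> F \<longrightarrow> (x, y) \<in> ?R)"
    by (rule conn_subset_iff) (use F edge_verts[OF G] in blast)
  also have "\<dots> \<longleftrightarrow> (\<forall>x y. {x, y} \<in> F \<longrightarrow> f x = f y)"
    using F edge_verts[OF G] by (simp add: subset_iff) metis
  also have "\<dots> \<longleftrightarrow> F \<subseteq> mono_edges G f"
  proof
    assume *: "\<forall>x y. {x, y} \<in> F \<longrightarrow> f x = f y"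
    show "F \<subseteq> mono_edges G f"
    proof
      fix e assume e: "e \<in> F"
      then have "e \<in> edges G" using F by blast
      moreover from this obtain x y where "e = {x, y}" by (rule edge_pair[OF G])
      ultimately show "e \<in> mono_edges G f" using e * by (simp add: edge_mono_edges_iff)
    qed
  next
    assume "F \<subseteq> mono_edges G f"
    then show "\<forall>x y. {x, y} \<in> F \<longrightarrow> f x = f y"
      by (metis edge_mono_edges_iff subsetD)
  qed
  finally show ?thesis by (auto simp: conn_def)
qed

lemma sum_Pow_alternating:
  assumes "finite M"
  shows "(\<Sum>F\<in>Pow M. (-1) ^ card F) = (if M = {} then 1 else 0 :: 'b :: comm_ring_1)"
proof -
  have "(\<Sum>F\<in>Pow M. (-1) ^ card F) = (\<Prod>e\<in>M. 1 - 1 :: 'b)"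
    unfolding prod_diff_conv_sum[OF assms] by simp
  then show ?thesis using assms by (simp add: power_0_left)
qed

text \<open>Inclusion-exclusion: the alternating sum over the subsets of the monochromatic edges of \<open>f\<close>
  detects whether \<open>f\<close> is proper. After exchanging the sums, the maps that are constant along \<open>F\<close>
  are those that are constant on its components. The identity also holds for \<open>k = 0\<close>, which later
  gives the vanishing of constant terms.\<close>
lemma card_colourings_expansion:
  assumes G: "fin_graph G"
  shows "of_nat (card (colourings G k)) =
    (\<Sum>F\<in>Pow (edges G). (-1) ^ card F * of_nat k ^ card (verts G // conn (verts G) F) :: rat)"
proof -
  let ?A = "verts G \<rightarrow>\<^sub>E {1..k}" and ?E = "edges G" and ?V = "verts G"
  have V: "finite ?V" using G by (simp add: fin_graph_def)
  then have A: "finite ?A" by (simp add: finite_PiE)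
  have E: "finite ?E" by (rule finite_edges[OF G])
  have M: "finite (mono_edges G f)" for f :: "'a \<Rightarrow> nat"
    using mono_edges_subset E by (rule finite_subset)
  have "of_nat (card (colourings G k)) = (\<Sum>f\<in>?A. if mono_edges G f = {} then 1 else 0 :: rat)"
    using A by (simp add: colourings_eq[OF G] flip: sum.inter_filter)
  also have "\<dots> = (\<Sum>f\<in>?A. \<Sum>F\<in>Pow (mono_edges G f). (-1) ^ card F)"
    by (simp add: sum_Pow_alternating[OF M])
  also have "\<dots> = (\<Sum>f\<in>?A. \<Sum>F | F \<in> Pow ?E \<and> F \<subseteq> mono_edges G f. (-1) ^ card F)"
    using mono_edges_subset by (intro sum.cong refl) blast+
  also have "\<dots> = (\<Sum>F\<in>Pow ?E. \<Sum>f | f \<in> ?A \<and> F \<subseteq> mono_edges G f. (-1) ^ card F)"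
    using A E by (intro sum.swap_restrict) simp_all
  also have "\<dots> = (\<Sum>F\<in>Pow ?E. (-1) ^ card F * of_nat k ^ card (?V // conn ?V F))"
  proof (rule sum.cong[OF refl])
    fix F assume "F \<in> Pow ?E"
    then have "{f \<in> ?A. F \<subseteq> mono_edges G f} = {f \<in> ?A. \<forall>(x, y)\<in>conn ?V F. f x = f y}"
      using subset_mono_edges_iff[OF G] by blast
    then have "card {f \<in> ?A. F \<subseteq> mono_edges G f} = k ^ card (?V // conn ?V F)"
      using card_constant_on_classes[OF V equiv_conn, of "{1..k}" F] by simp
    then show "(\<Sum>f | f \<in> ?A \<and> F \<subseteq> mono_edges G f. (-1) ^ card F) =
        (-1) ^ card F * (of_nat k ^ card (?V // conn ?V F) :: rat)"
      by simp
  qed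
  finally show ?thesis .
qed

lemma poly_eqI_of_nat:
  fixes p q :: "'b :: {idom, ring_char_0} poly"
  assumes "\<And>k :: nat. k \<ge> 1 \<Longrightarrow> poly p (of_nat k) = poly q (of_nat k)"
  shows "p = q"
proof (rule ccontr)
  assume "p \<noteq> q"
  then have "finite {x. poly (p - q) x = 0}" by (intro poly_roots_finite) simp
  moreover have "of_nat ` {1..} \<subseteq> {x. poly (p - q) x = 0}" using assms by auto
  ultimately have "finite (of_nat ` {1..} :: 'b set)" by (rule rev_finite_subset)
  then have "finite {1 :: nat..}" by (rule finite_imageD) (simp add: inj_on_def)
  then show False by (simp add: infinite_Ici)
qed

text \<open>Whitney's expansion. It supplies the existence half of the definite description of the
  chromatic polynomial; infinitely many common values give uniqueness.\<close>
lemma chrom_poly_Pow: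
  assumes G: "fin_graph G"
  shows "chrom_poly G = (\<Sum>F\<in>Pow (edges G). monom ((-1) ^ card F) (card (verts G // conn (verts G) F)))"
    (is "_ = ?w")
  unfolding chrom_poly_def
proof (rule the_equality)
  show "\<forall>k\<ge>1. poly ?w (of_nat k) = of_nat (card (colourings G k))"
    by (simp add: card_colourings_expansion[OF G] poly_sum poly_monom)
  then show "p = ?w" if "\<forall>k\<ge>1. poly p (of_nat k) = of_nat (card (colourings G k))" for p
    using that by (intro poly_eqI_of_nat) simp
qed

lemma poly_chrom_poly:
  "fin_graph G \<Longrightarrow> poly (chrom_poly G) (of_nat k) = of_nat (card (colourings G k))"
  by (simp add: chrom_poly_Pow card_colourings_expansion poly_sum poly_monom)


section \<open>The chromatic character as a coefficient\<close>

text \<open>No edge joins two components, so a colouring amounts to an independent choice of a colouring of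
  each component.\<close>
lemma card_colourings_components:
  assumes G: "fin_graph G"
  shows "card (colourings G k) = (\<Prod>C\<in>components G. card (colourings (induced G C) k))"
proof -
  let ?V = "verts G" and ?K = "components G" and ?t = "conn (verts G) (edges G)"
  let ?B = "\<Pi>\<^sub>E C\<in>?K. colourings (induced G C) k"
  let ?split = "\<lambda>f. \<lambda>C\<in>?K. restrict f C" and ?glue = "\<lambda>h. \<lambda>x\<in>?V. h (?t `` {x}) x"
  have own: "?t `` {x} \<in> ?K" "x \<in> ?t `` {x}" if "x \<in> ?V" for x
    using that by (simp_all add: components_eq quotientI) (simp add: conn_def)
  have cls: "?t `` {x} = C" "x \<in> ?V" if "C \<in> ?K" "x \<in> C" for x C
  proof -
    obtain a where "C = ?t `` {a}" using \<open>C \<in> ?K\<close> unfolding components_eq by (rule quotientE)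
    then have "(a, x) \<in> ?t" using \<open>x \<in> C\<close> by simp
    then show "?t `` {x} = C" using \<open>C = ?t `` {a}\<close> by (simp add: equiv_class_eq[OF equiv_conn])
    show "x \<in> ?V" using \<open>(a, x) \<in> ?t\<close> by (simp add: conn_def)
  qed
  have induced_edge: "{x, y} \<in> edges (induced G C) \<longleftrightarrow> {x, y} \<in> edges G \<and> x \<in> C \<and> y \<in> C" for x y C
    by (simp add: induced_def)
  have "bij_betw ?split (colourings G k) ?B"
  proof (rule bij_betw_byWitness[where f' = ?glue])
    show "\<forall>f\<in>colourings G k. ?glue (?split f) = f"
    proof (intro ballI ext)
      fix f x assume "f \<in> colourings G k"
      then have ext: "f \<in> extensional ?V" by (simp add: colourings_def PiE_def)
      show "?glue (?split f) x = f x"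
      proof (cases "x \<in> ?V")
        case True
        then show ?thesis by (simp only: restrict_apply own if_True)
      next
        case False
        then show ?thesis by (simp only: restrict_apply if_False extensional_arb[OF ext False])
      qed
    qed
    show "\<forall>h\<in>?B. ?split (?glue h) = h"
    proof (intro ballI ext)
      fix h C x assume h: "h \<in> ?B"
      show "?split (?glue h) C x = h C x"
      proof (cases "C \<in> ?K")
        case True
        then have ext: "h C \<in> extensional C"
          using PiE_mem[OF h True] by (simp add: colourings_def PiE_def induced_def)
        show ?thesis
        proof (cases "x \<in> C")
          case x: True
          then show ?thesis by (simp only: restrict_apply True cls[OF True x] if_True)
        next
          case False
          then show ?thesis by (simp only: restrict_apply True if_True if_False extensional_arb[OF ext False])
        qed
      next
        case False
        then show ?thesis by (simp only: restrict_apply if_False PiE_arb[OF h False])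
      qed
    qed
    show "?split ` colourings G k \<subseteq> ?B"
    proof (rule image_subsetI)
      fix f assume f: "f \<in> colourings G k"
      have "restrict f C \<in> colourings (induced G C) k" if C: "C \<in> ?K" for C
      proof (rule colouringsI)
        have "f x \<in> {1..k}" if "x \<in> C" for x
          using PiE_mem[OF colouringsD(1)[OF f] cls(2)[OF C that]] .
        then show "restrict f C \<in> verts (induced G C) \<rightarrow>\<^sub>E {1..k}" by (simp add: induced_def)
        show "restrict f C x \<noteq> restrict f C y" if "{x, y} \<in> edges (induced G C)" for x y
          using that colouringsD(2)[OF f, of x y] by (simp add: induced_edge)
      qed
      then show "?split f \<in> ?B" by simp
    qed
    show "?glue ` ?B \<subseteq> colourings G k"
    proof (rule image_subsetI)
      fix h assume h: "h \<in> ?B"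
      note hC = PiE_mem[OF h own(1)]
      show "?glue h \<in> colourings G k"
      proof (rule colouringsI)
        have "h (?t `` {x}) x \<in> {1..k}" if "x \<in> ?V" for x
          by (rule PiE_mem[OF colouringsD(1)[OF hC[OF that]]]) (simp add: induced_def own(2)[OF that] del: Image_singleton_iff)
        then show "?glue h \<in> ?V \<rightarrow>\<^sub>E {1..k}" by simp
        fix x y assume xy: "{x, y} \<in> edges G"
        have V: "x \<in> ?V" "y \<in> ?V" using edge_verts[OF G xy] by auto
        have same: "?t `` {y} = ?t `` {x}"
          using conn_edge[OF V xy] equiv_class_eq[OF equiv_conn] by metis
        have "{x, y} \<in> edges (induced G (?t `` {x}))"
          using xy own(2)[OF V(1)] own(2)[OF V(2)] unfolding same induced_edge by blast
        then have "h (?t `` {x}) x \<noteq> h (?t `` {x}) y" by (rule colouringsD(2)[OF hC[OF V(1)]])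
        then show "?glue h x \<noteq> ?glue h y" by (simp only: restrict_apply V same if_True) simp
      qed
    qed
  qed
  then have "card (colourings G k) = card ?B" by (rule bij_betw_same_card)
  then show ?thesis by (simp add: card_PiE finite_components[OF G])
qed

lemma chrom_poly_components:
  assumes G: "fin_graph G"
  shows "chrom_poly G = (\<Prod>C\<in>components G. chrom_poly (induced G C))"
proof (rule poly_eqI_of_nat)
  have "fin_graph (induced G C)" if "C \<in> components G" for C
    using fin_graph_induced[OF G component_subset[OF that]] .
  then show "poly (chrom_poly G) (of_nat k) = poly (\<Prod>C\<in>components G. chrom_poly (induced G C)) (of_nat k)" for k
    by (simp add: poly_chrom_poly G poly_prod card_colourings_components)
qed

text \<open>Each factor is divisible by \<open>X\<close>, so the coefficient in question is the constant term of the
  product of the quotients.\<close>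
lemma coeff_prod_card:
  fixes p :: "'i \<Rightarrow> 'b :: comm_ring_1 poly"
  assumes "\<And>i. i \<in> A \<Longrightarrow> coeff (p i) 0 = 0"
  shows "coeff (\<Prod>i\<in>A. p i) (card A) = (\<Prod>i\<in>A. coeff (p i) 1)"
proof -
  have "p i = monom 1 1 * poly_shift 1 (p i)" if "i \<in> A" for i
    using assms[OF that] by (intro poly_eqI) (simp add: coeff_monom_mult coeff_poly_shift)
  then have "(\<Prod>i\<in>A. p i) = (\<Prod>i\<in>A. monom 1 1 * poly_shift 1 (p i))" by (rule prod.cong[OF refl])
  also have "\<dots> = monom 1 (card A) * (\<Prod>i\<in>A. poly_shift 1 (p i))"
    by (simp add: prod.distrib monom_power)
  finally have "coeff (\<Prod>i\<in>A. p i) (card A) = poly (\<Prod>i\<in>A. poly_shift 1 (p i)) 0"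
    by (simp add: coeff_monom_mult poly_0_coeff_0)
  then show ?thesis unfolding poly_prod by (simp add: poly_0_coeff_0 coeff_poly_shift)
qed

text \<open>A nonempty graph has no colouring with 0 colours, so the chromatic polynomial of each component
  has no constant term.\<close>
lemma lambda_chr_graph_eq_coeff:
  assumes G: "fin_graph G"
  shows "lambda_chr_graph G = coeff (chrom_poly G) (card (components G))"
proof -
  have "coeff (chrom_poly (induced G C)) 0 = 0" if "C \<in> components G" for C
  proof -
    have "C \<noteq> {}" using that by (auto simp: components_eq elim!: quotientE) (auto simp: conn_def)
    then have "colourings (induced G C) 0 = {}" by (auto simp: colourings_def induced_def PiE_eq_empty_iff)
    then have "poly (chrom_poly (induced G C)) (of_nat 0) = 0"
      by (simp only: poly_chrom_poly[OF fin_graph_induced[OF G component_subset[OF that]]]) simp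
    then show ?thesis by (simp add: poly_0_coeff_0)
  qed
  then show ?thesis
    unfolding lambda_chr_graph_def chrom_poly_components[OF G]
    by (subst coeff_prod_card) (simp_all add: poly_0_coeff_0 coeff_pderiv)
qed

text \<open>An edge subset contributes to this coefficient if it has as many components as \<open>G\<close>; since its
  components refine those of \<open>G\<close>, they then coincide with them.\<close>
lemma lambda_chr_graph_Pow:
  assumes G: "fin_graph G"
  shows "lambda_chr_graph G =
    (\<Sum>F | F \<subseteq> edges G \<and> conn (verts G) F = conn (verts G) (edges G). (-1) ^ card F)"
proof -
  let ?V = "verts G"
  have V: "finite ?V" using G by (simp add: fin_graph_def)
  have "card (?V // conn ?V F) = card (components G) \<longleftrightarrow> conn ?V F = conn ?V (edges G)"
    if "F \<subseteq> edges G" for F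
    using refinement_eq_if_card_eq[OF V equiv_conn equiv_conn conn_mono[OF that]]
    by (auto simp: components_eq)
  then have "lambda_chr_graph G =
      (\<Sum>F\<in>Pow (edges G). if conn ?V F = conn ?V (edges G) then (-1) ^ card F else 0)"
    unfolding lambda_chr_graph_eq_coeff[OF G] chrom_poly_Pow[OF G] coeff_sum
    by (intro sum.cong refl) simp
  then show ?thesis using finite_edges[OF G] by (simp add: sum.inter_filter[symmetric])
qed

text \<open>The expansion is grouped by the partition \<open>r\<close> into the components of \<open>F\<close>. All edges of such
  an \<open>F\<close> lie inside classes of \<open>r\<close>, so \<open>F\<close> is an edge subset of \<open>G|r\<close> with the same components as
  \<open>G|r\<close>, and these are the subsets that enter \<open>\<lambda>_chr(G|r)\<close>.\<close>
lemma chrom_poly_admissible: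
  assumes G: "fin_graph G"
  shows "chrom_poly G = (\<Sum>r | r \<triangleleft> G. monom (lambda_chr_graph (restr_graph G r)) (cl G r))"
proof -
  let ?V = "verts G" and ?E = "edges G"
  let ?m = "\<lambda>F. monom ((-1) ^ card F) (card (?V // conn ?V F)) :: rat poly"
  have "chrom_poly G = (\<Sum>r | r \<triangleleft> G. \<Sum>F | F \<in> Pow ?E \<and> conn ?V F = r. ?m F)"
    unfolding chrom_poly_Pow[OF G]
    using finite_edges[OF G] admissible_eq_image_conn[OF G] finite_admissible[OF G]
    by (intro sum.group[symmetric]) simp_all
  also have "\<dots> = (\<Sum>r | r \<triangleleft> G. monom (lambda_chr_graph (restr_graph G r)) (cl G r))"
  proof (rule sum.cong[OF refl])
    fix r assume "r \<in> {r. r \<triangleleft> G}"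
    then have r: "r \<triangleleft> G" and eq: "equiv ?V r" by (simp_all add: admissible_def)
    let ?F = "edges (restr_graph G r)"
    have "F \<subseteq> ?F" if F: "F \<subseteq> ?E" "conn ?V F = r" for F
    proof
      fix e assume e: "e \<in> F"
      then have "e \<in> ?E" using F(1) by blast
      moreover from this obtain x y where xy: "e = {x, y}" by (rule edge_pair[OF G])
      moreover from calculation have "(x, y) \<in> r" using conn_edge edge_verts[OF G] e F(2) by metis
      ultimately show "e \<in> ?F" by (simp add: edge_restr_graph_iff[OF eq])
    qed
    then have Fs: "{F \<in> Pow ?E. conn ?V F = r} = {F. F \<subseteq> ?F \<and> conn ?V F = conn ?V ?F}"
      using edges_restr_graph_subset[of G r] conn_restr_graph[OF G r] by auto
    have "(\<Sum>F | F \<in> Pow ?E \<and> conn ?V F = r. ?m F) =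
        (\<Sum>F | F \<in> Pow ?E \<and> conn ?V F = r. monom ((-1) ^ card F) (cl G r))"
      by (rule sum.cong) (simp_all add: cl_def)
    also have "\<dots> = monom (lambda_chr_graph (restr_graph G r)) (cl G r)"
      unfolding Fs lambda_chr_graph_Pow[OF fin_graph_restr_graph[OF G]]
      by (simp add: restr_graph_def poly_eq_iff coeff_sum)
    finally show "(\<Sum>F | F \<in> Pow ?E \<and> conn ?V F = r. ?m F) =
        monom (lambda_chr_graph (restr_graph G r)) (cl G r)" .
  qed
  finally show ?thesis .
qed

text \<open>Both sides are the value of the chromatic polynomial at 1.\<close>
lemma sum_lambda_restr_graph:
  assumes G: "fin_graph G"
  shows "(\<Sum>r | r \<triangleleft> G. lambda_chr_graph (restr_graph G r)) = (if edges G = {} then 1 else 0)"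
proof -
  have "(\<Sum>r | r \<triangleleft> G. lambda_chr_graph (restr_graph G r)) = poly (chrom_poly G) 1"
    by (simp add: chrom_poly_admissible[OF G] poly_sum poly_monom)
  also have "\<dots> = (\<Sum>F\<in>Pow (edges G). (-1) ^ card F)"
    by (simp add: chrom_poly_Pow[OF G] poly_sum poly_monom)
  finally show ?thesis by (simp add: sum_Pow_alternating finite_edges[OF G])
qed

text \<open>A colouring of \<open>G/r\<close> pulls back to a map on the vertices of \<open>G\<close>. Properness says that edges
  between different classes are bichromatic, so the monochromatic edges of the pullback are those
  of \<open>G|r\<close>, whose components are \<open>r\<close>. Conversely, a map whose monochromatic edges have the
  components \<open>r\<close> descends to the classes, and an edge of \<open>G/r\<close> with ends of equal colour would come
  from a monochromatic edge between two of these components.\<close>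
lemma card_colourings_quot_graph:
  assumes G: "fin_graph G" and r: "r \<triangleleft> G"
  shows "card (colourings (quot_graph G r) k) =
    card {f \<in> verts G \<rightarrow>\<^sub>E {1..k}. conn (verts G) (mono_edges G f) = r}"
proof -
  let ?V = "verts G" and ?Q = "quot_graph G r" and ?h = "lift_fun (verts G) r"
  let ?A = "?V // r \<rightarrow>\<^sub>E {1..k}"
  have eq: "equiv ?V r" using r by (simp add: admissible_def)
  have VQ: "verts ?Q = ?V // r" by (simp add: quot_graph_def)
  have h: "?h g x = g (r `` {x})" if "x \<in> ?V" for g :: "'a set \<Rightarrow> nat" and x
    using that by (simp add: lift_fun_def)
  have iff: "g \<in> colourings ?Q k \<longleftrightarrow> conn ?V (mono_edges G (?h g)) = r" if g: "g \<in> ?A" for g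
  proof
    assume "g \<in> colourings ?Q k"
    note proper = colouringsD(2)[OF this]
    have "mono_edges G (?h g) = edges (restr_graph G r)"
    proof (rule Set.set_eqI)
      fix e
      show "e \<in> mono_edges G (?h g) \<longleftrightarrow> e \<in> edges (restr_graph G r)"
      proof (cases "e \<in> edges G")
        case True
        then obtain x y where e: "e = {x, y}" by (rule edge_pair[OF G])
        then have xy: "{x, y} \<in> edges G" using True by simp
        then have V: "x \<in> ?V" "y \<in> ?V" using edge_verts[OF G] by auto
        have "g (r `` {x}) = g (r `` {y}) \<longleftrightarrow> r `` {x} = r `` {y}"
          using edge_quot_graphI[OF G eq xy] proper[of "r `` {x}" "r `` {y}"] by metis
        then show ?thesis
          using xy V by (simp add: e edge_mono_edges_iff edge_restr_graph_iff[OF eq] h eq_equiv_class_iff[OF eq])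
      next
        case False
        then show ?thesis using mono_edges_subset edges_restr_graph_subset by blast
      qed
    qed
    then show "conn ?V (mono_edges G (?h g)) = r" by (simp add: conn_restr_graph[OF G r])
  next
    assume conn: "conn ?V (mono_edges G (?h g)) = r"
    have proper: "g C \<noteq> g D" if CD: "{C, D} \<in> edges ?Q" for C D
    proof
      assume same: "g C = g D"
      obtain u v where uv: "{u, v} \<in> edges G" "u \<in> ?V" "v \<in> ?V" "C = r `` {u}" "D = r `` {v}"
          "r `` {u} \<noteq> r `` {v}"
        by (rule edge_quot_graphE[OF eq CD])
      then have "{u, v} \<in> mono_edges G (?h g)" using same by (simp add: edge_mono_edges_iff h)
      then have "(u, v) \<in> r" using conn_edge[OF uv(2,3)] conn by blast
      then show False using uv(6) equiv_class_eq[OF eq] by blast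
    qed
    show "g \<in> colourings ?Q k" by (rule colouringsI) (use g VQ in simp, rule proper)
  qed
  note bij = bij_betw_lift_fun[OF eq, of "{1..k}"]
  have sub: "colourings ?Q k \<subseteq> ?A" using colouringsD(1) by (metis VQ subsetI)
  have "?h ` colourings ?Q k = {f \<in> ?V \<rightarrow>\<^sub>E {1..k}. conn ?V (mono_edges G f) = r}"
  proof
    show "?h ` colourings ?Q k \<subseteq> {f \<in> ?V \<rightarrow>\<^sub>E {1..k}. conn ?V (mono_edges G f) = r}"
    proof (rule image_subsetI)
      fix g assume g: "g \<in> colourings ?Q k"
      then have "g \<in> ?A" using sub by (rule rev_subsetD)
      then show "?h g \<in> {f \<in> ?V \<rightarrow>\<^sub>E {1..k}. conn ?V (mono_edges G f) = r}"
        using g iff bij_betwE[OF bij] by simp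
    qed
    show "{f \<in> ?V \<rightarrow>\<^sub>E {1..k}. conn ?V (mono_edges G f) = r} \<subseteq> ?h ` colourings ?Q k"
    proof
      fix f assume "f \<in> {f \<in> ?V \<rightarrow>\<^sub>E {1..k}. conn ?V (mono_edges G f) = r}"
      then have f: "f \<in> ?V \<rightarrow>\<^sub>E {1..k}" "conn ?V (mono_edges G f) = r" by simp_all
      then have "\<forall>(x, y)\<in>r. f x = f y"
        using subset_mono_edges_iff[OF G mono_edges_subset, of f f] by simp
      then have "f \<in> ?h ` ?A" using f(1) bij_betw_imp_surj_on[OF bij] by simp
      then obtain g where "g \<in> ?A" "f = ?h g" by blast
      then show "f \<in> ?h ` colourings ?Q k" using iff[of g] f(2) by simp
    qed
  qed
  moreover have "inj_on ?h (colourings ?Q k)"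
    using bij_betw_imp_inj_on[OF bij] sub by (rule inj_on_subset)
  ultimately show ?thesis by (metis card_image)
qed

text \<open>The maps from the vertices of \<open>G\<close> to \<open>k\<close> colours are sorted by the components of their
  monochromatic edges.\<close>
lemma sum_chrom_poly_quot_graph:
  assumes G: "fin_graph G"
  shows "(\<Sum>r | r \<triangleleft> G. chrom_poly (quot_graph G r)) = monom 1 (card (verts G))"
proof (rule poly_eqI_of_nat)
  fix k :: nat
  let ?A = "verts G \<rightarrow>\<^sub>E {1..k}" and ?c = "\<lambda>f :: 'a \<Rightarrow> nat. conn (verts G) (mono_edges G f)"
  have V: "finite (verts G)" using G by (simp add: fin_graph_def)
  then have A: "finite ?A" by (simp add: finite_PiE)
  have "(\<Sum>r | r \<triangleleft> G. card (colourings (quot_graph G r) k)) = (\<Sum>r | r \<triangleleft> G. \<Sum>f | f \<in> ?A \<and> ?c f = r. 1)"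
    by (rule sum.cong) (simp_all add: card_colourings_quot_graph[OF G])
  also have "\<dots> = (\<Sum>f\<in>?A. 1)"
    using A finite_admissible[OF G] admissible_conn[OF G mono_edges_subset]
    by (intro sum.group) auto
  also have "\<dots> = k ^ card (verts G)" using V by (simp add: card_PiE)
  finally have "of_nat (\<Sum>r | r \<triangleleft> G. card (colourings (quot_graph G r) k)) = (of_nat k ^ card (verts G) :: rat)"
    by simp
  then show "poly (\<Sum>r | r \<triangleleft> G. chrom_poly (quot_graph G r)) (of_nat k) =
      poly (monom 1 (card (verts G))) (of_nat k)"
    by (simp add: poly_sum poly_monom poly_chrom_poly fin_graph_quot_graph[OF G])
qed

text \<open>The graphs \<open>G/r\<close> have as many components as \<open>G\<close>, so all the values of \<open>\<lambda>_chr\<close> can be read off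
  from the coefficient of one and the same power of \<open>X\<close> in the preceding identity.\<close>
lemma sum_lambda_quot_graph:
  assumes G: "fin_graph G"
  shows "(\<Sum>r | r \<triangleleft> G. lambda_chr_graph (quot_graph G r)) = (if edges G = {} then 1 else 0)"
proof -
  have "(\<Sum>r | r \<triangleleft> G. lambda_chr_graph (quot_graph G r)) =
      coeff (\<Sum>r | r \<triangleleft> G. chrom_poly (quot_graph G r)) (card (components G))"
    by (simp add: coeff_sum lambda_chr_graph_eq_coeff fin_graph_quot_graph[OF G]
        card_components_quot_graph[OF G])
  then show ?thesis
    using card_components_eq_card_verts_iff[OF G] by (auto simp: sum_chrom_poly_quot_graph[OF G])
qed


section \<open>Multiplicativity on disjoint unions\<close>

text \<open>For a copy of \<open>G\<close> inside \<open>K\<close> that no edge of \<open>K\<close> leaves, paths of \<open>K\<close> that start in the copy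
  are copies of paths of \<open>G\<close>. It is used for the two injections into a disjoint union.\<close>
lemma adj_rtrancl_embed:
  assumes step: "\<And>x z. (f x, z) \<in> adj_rel K \<longleftrightarrow> (\<exists>y. z = f y \<and> (x, y) \<in> adj_rel G)"
  shows "(f x, z) \<in> (adj_rel K)\<^sup>* \<longleftrightarrow> (\<exists>y. z = f y \<and> (x, y) \<in> (adj_rel G)\<^sup>*)"
proof
  assume "(f x, z) \<in> (adj_rel K)\<^sup>*"
  then show "\<exists>y. z = f y \<and> (x, y) \<in> (adj_rel G)\<^sup>*"
  proof (induction rule: rtrancl_induct)
    case (step z z')
    then obtain y where y: "z = f y" "(x, y) \<in> (adj_rel G)\<^sup>*" by blast
    then have "(f y, z') \<in> adj_rel K" using step(2) by simp
    then obtain y' where "z' = f y'" and yy': "(y, y') \<in> adj_rel G" unfolding assms by blast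
    from yy' have "(x, y') \<in> (adj_rel G)\<^sup>*" by (rule rtrancl.rtrancl_into_rtrancl[OF y(2)])
    then show ?case using \<open>z' = f y'\<close> by blast
  qed blast
next
  have "(f x, f y) \<in> (adj_rel K)\<^sup>*" if "(x, y) \<in> (adj_rel G)\<^sup>*" for y
    using that
  proof (induction rule: rtrancl_induct)
    case (step y z)
    then have "(f y, f z) \<in> adj_rel K" using assms by blast
    then show ?case using step.IH by (rule rtrancl.rtrancl_into_rtrancl[rotated])
  qed simp
  then show "\<exists>y. z = f y \<and> (x, y) \<in> (adj_rel G)\<^sup>* \<Longrightarrow> (f x, z) \<in> (adj_rel K)\<^sup>*" by blast
qed

lemma adj_rel_disj_union:
  "(Inl x, z) \<in> adj_rel (disj_union G H) \<longleftrightarrow> (\<exists>y. z = Inl y \<and> (x, y) \<in> adj_rel G)"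
  "(Inr x', z) \<in> adj_rel (disj_union G H) \<longleftrightarrow> (\<exists>y. z = Inr y \<and> (x', y) \<in> adj_rel H)"
proof -
  have "{Inl x, z} = Inl ` e \<longleftrightarrow> (\<exists>y. z = Inl y \<and> e = {x, y})" for e :: "'a set" and z :: "'a + 'b"
    by (cases z) auto
  moreover have "{Inl x, z} \<noteq> Inr ` e" for e :: "'b set" and z :: "'a + 'b" by auto
  ultimately show "(Inl x, z) \<in> adj_rel (disj_union G H) \<longleftrightarrow> (\<exists>y. z = Inl y \<and> (x, y) \<in> adj_rel G)"
    by (auto simp: adj_rel_def disj_union_def image_iff)
  have "{Inr x', z} = Inr ` e \<longleftrightarrow> (\<exists>y. z = Inr y \<and> e = {x', y})" for e :: "'b set" and z :: "'a + 'b"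
    by (cases z) auto
  moreover have "{Inr x', z} \<noteq> Inl ` e" for e :: "'a set" and z :: "'a + 'b" by auto
  ultimately show "(Inr x', z) \<in> adj_rel (disj_union G H) \<longleftrightarrow> (\<exists>y. z = Inr y \<and> (x', y) \<in> adj_rel H)"
    by (auto simp: adj_rel_def disj_union_def image_iff)
qed

lemma components_disj_union:
  "components (disj_union G H) = image Inl ` components G \<union> image Inr ` components H"
proof -
  let ?t = "conn (verts (disj_union G H)) (edges (disj_union G H))"
  have t: "?t = {(x, y) \<in> (verts G <+> verts H) \<times> (verts G <+> verts H).
      (x, y) \<in> (adj_rel (disj_union G H))\<^sup>*}"
    by (simp add: conn_def) (simp add: disj_union_def)
  have cls: "?t `` {Inl x} = Inl ` (conn (verts G) (edges G) `` {x})" if "x \<in> verts G" for x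
    unfolding t using that
    by (auto simp: conn_def image_iff adj_rtrancl_embed[where f = Inl, OF adj_rel_disj_union(1)[of _ _ G H]])
  have cls': "?t `` {Inr x} = Inr ` (conn (verts H) (edges H) `` {x})" if "x \<in> verts H" for x
    unfolding t using that
    by (auto simp: conn_def image_iff adj_rtrancl_embed[where f = Inr, OF adj_rel_disj_union(2)[of _ _ G H]])
  have "components (disj_union G H) = (\<lambda>z. ?t `` {z}) ` (Inl ` verts G \<union> Inr ` verts H)"
    unfolding components_eq quotient_def by (auto simp: disj_union_def)
  also have "\<dots> = (\<lambda>x. Inl ` (conn (verts G) (edges G) `` {x})) ` verts G \<union>
      (\<lambda>x. Inr ` (conn (verts H) (edges H) `` {x})) ` verts H"
    unfolding image_Un image_image by (intro arg_cong2[where f = "(\<union>)"] image_cong refl) (simp_all add: cls cls')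
  also have "\<dots> = image Inl ` components G \<union> image Inr ` components H"
    unfolding components_eq quotient_def by auto
  finally show ?thesis .
qed

lemma induced_disj_union:
  assumes "fin_graph G" "fin_graph H"
  shows "induced (disj_union G H) (Inl ` C) = relabel Inl (induced G C)"
    and "induced (disj_union G H) (Inr ` D) = relabel Inr (induced H D)"
proof -
  have ne: "{} \<notin> edges G" "{} \<notin> edges H" using assms by (auto simp: fin_graph_def)
  have sub: "Inl ` e \<subseteq> Inl ` C \<longleftrightarrow> e \<subseteq> C" "Inr ` e' \<subseteq> Inr ` D \<longleftrightarrow> e' \<subseteq> D"
    "Inr ` e' \<subseteq> Inl ` C \<longleftrightarrow> e' = {}" "Inl ` e \<subseteq> Inr ` D \<longleftrightarrow> e = {}"
    for e :: "'a set" and e' :: "'b set" by auto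
  have "{e \<in> image Inl ` edges G \<union> image Inr ` edges H. e \<subseteq> Inl ` C} = image Inl ` {e \<in> edges G. e \<subseteq> C}"
    using ne(2) by (auto simp: sub)
  then show "induced (disj_union G H) (Inl ` C) = relabel Inl (induced G C)"
    by (simp add: induced_def disj_union_def relabel_def)
  have "{e \<in> image Inl ` edges G \<union> image Inr ` edges H. e \<subseteq> Inr ` D} = image Inr ` {e \<in> edges H. e \<subseteq> D}"
    using ne(1) by (auto simp: sub)
  then show "induced (disj_union G H) (Inr ` D) = relabel Inr (induced H D)"
    by (simp add: induced_def disj_union_def relabel_def)
qed

lemma lambda_chr_graph_disj_union:
  assumes "fin_graph G" "fin_graph H"
  shows "lambda_chr_graph (disj_union G H) = lambda_chr_graph G * lambda_chr_graph H"
proof -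
  let ?p = "\<lambda>K C. poly (pderiv (chrom_poly (induced K C))) 0"
  have ne: "C \<noteq> {}" if "C \<in> components K" for C :: "'c set" and K
    using that unfolding components_eq by (rule quotientE) (auto simp: conn_def)
  have disj: "image Inl ` components G \<inter> image Inr ` components H = {}"
  proof (rule equals0I)
    fix X assume "X \<in> image Inl ` components G \<inter> image Inr ` components H"
    then have X: "X \<in> image Inl ` components G" "X \<in> image Inr ` components H" by simp_all
    obtain C where C: "X = Inl ` C" "C \<in> components G" using X(1) by (rule imageE)
    obtain D where D: "X = Inr ` D" using X(2) by (rule imageE)
    obtain x where "x \<in> C" using ne[OF C(2)] by blast
    then have "Inl x \<in> X" unfolding C(1) by (rule imageI)
    then show False unfolding D by auto
  qed
  have inj: "inj_on (image Inl) (components G)" "inj_on (image Inr) (components H)"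
    by (simp_all add: inj_on_def inj_image_eq_iff)
  have G: "?p (disj_union G H) (Inl ` C) = ?p G C" if "C \<in> components G" for C
    using fin_graph_induced[OF assms(1) component_subset[OF that]]
    by (simp add: induced_disj_union[OF assms] chrom_poly_relabel)
  have H: "?p (disj_union G H) (Inr ` C) = ?p H C" if "C \<in> components H" for C
    using fin_graph_induced[OF assms(2) component_subset[OF that]]
    by (simp add: induced_disj_union[OF assms] chrom_poly_relabel)
  have "lambda_chr_graph (disj_union G H) = prod (?p (disj_union G H)) (image Inl ` components G) *
      prod (?p (disj_union G H)) (image Inr ` components H)"
    unfolding lambda_chr_graph_def components_disj_union
    using assms disj by (intro prod.union_disjoint) (simp_all add: finite_components)
  also have "\<dots> = (\<Prod>C\<in>components G. ?p G C) * (\<Prod>C\<in>components H. ?p H C)"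
    by (simp only: prod.reindex[OF inj(1)] prod.reindex[OF inj(2)] comp_def G H cong: prod.cong)
  finally show ?thesis by (simp only: lambda_chr_graph_def)
qed

text \<open>Read off from the product of basis elements, since a basis element determines its class.\<close>
lemma iclass_disj_union:
  assumes "fin_graph G" "fin_graph H"
  shows "iclass (disj_union G H) = iclass G + iclass H"
proof -
  have "Poly_Mapping.single (iclass (disj_union G H)) (1 :: rat) = Poly_Mapping.single (iclass G + iclass H) 1"
    using gbasis_disj_union[OF assms] by (simp add: gbasis_def mult_single)
  then show ?thesis by (metis keys_single singleton_inject zero_neq_one)
qed

lemma ilambda_add: "ilambda (a + b) = ilambda a * ilambda b"
proof -
  obtain G :: "nat ugraph" where G: "fin_graph G" "iclass G = a" using iclass_surj by blast
  obtain H :: "nat ugraph" where H: "fin_graph H" "iclass H = b" using iclass_surj by blast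
  have "a + b = iclass (disj_union G H)" using G H by (simp add: iclass_disj_union)
  then have "ilambda (a + b) = lambda_chr_graph (disj_union G H)"
    by (simp only: ilambda_iclass[OF fin_graph_disj_union[OF G(1) H(1)]])
  also have "\<dots> = ilambda a * ilambda b"
    using G H by (simp add: lambda_chr_graph_disj_union ilambda_iclass[symmetric])
  finally show ?thesis .
qed

lemma ilambda_zero: "ilambda 0 = 1"
proof -
  let ?G = "({}, {}) :: nat ugraph"
  have "fin_graph ?G" by (simp add: fin_graph_def)
  moreover have "iclass ?G = 0" by (simp add: iclass_def relabel_def zero_igraph_def)
  ultimately have "ilambda 0 = lambda_chr_graph ?G" using ilambda_iclass[of ?G] by simp
  then show ?thesis by (simp add: lambda_chr_graph_def components_def)
qed


section \<open>Linear extension\<close>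

lemma vector_space_times: "vector_space ((*) :: rat \<Rightarrow> rat \<Rightarrow> rat)"
  by unfold_locales (simp_all add: algebra_simps)

lemma vector_space_smult: "vector_space (smult :: rat \<Rightarrow> rat poly \<Rightarrow> rat poly)"
  by unfold_locales (simp_all add: smult_add_right smult_add_left)

lemma linear_lin_ext:
  assumes s: "vector_space s"
  shows "Vector_Spaces.linear pm_scale s (lin_ext s f)"
proof -
  interpret vector_space s by (rule s)
  have superset: "lin_ext s f x = (\<Sum>b\<in>B. s (Poly_Mapping.lookup x b) (f b))"
    if "finite B" "Poly_Mapping.keys x \<subseteq> B" for x B
    unfolding lin_ext_def using that by (intro sum.mono_neutral_left) (auto simp: in_keys_iff)
  have "lin_ext s f (x + y) = lin_ext s f x + lin_ext s f y" for x y
  proof -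
    let ?B = "Poly_Mapping.keys x \<union> Poly_Mapping.keys y"
    have "Poly_Mapping.keys (x + y) \<subseteq> ?B" by (rule Poly_Mapping.keys_add)
    then show ?thesis
      by (simp add: superset[of ?B] lookup_add scale_left_distrib sum.distrib)
  qed
  moreover have "lin_ext s f (pm_scale c x) = s c (lin_ext s f x)" for c x
  proof -
    have "Poly_Mapping.keys (pm_scale c x) \<subseteq> Poly_Mapping.keys x"
      by (auto simp: in_keys_iff lookup_pm_scale)
    then show ?thesis
      by (simp add: superset[of "Poly_Mapping.keys x"] lookup_pm_scale scale_sum_right)
  qed
  ultimately show ?thesis
    using s pm_scale_vector_space by (simp add: Vector_Spaces.linear_iff)
qed

lemma pm_scale_single: "pm_scale c (Poly_Mapping.single b d) = Poly_Mapping.single b (c * d)"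
  by (rule poly_mapping_eqI) (simp add: lookup_pm_scale lookup_single when_def)

lemma sum_pm_scale_single:
  "(\<Sum>b\<in>Poly_Mapping.keys x. pm_scale (Poly_Mapping.lookup x b) (Poly_Mapping.single b 1)) = x"
  by (rule poly_mapping_eqI)
    (auto simp: lookup_sum pm_scale_single lookup_single when_def in_keys_iff)

lemma linear_eq_lin_ext:
  assumes "Vector_Spaces.linear pm_scale s \<phi>"
  shows "\<phi> x = lin_ext s (\<lambda>b. \<phi> (Poly_Mapping.single b 1)) x"
proof -
  interpret Vector_Spaces.linear pm_scale s \<phi> by (rule assms)
  have "\<phi> x = \<phi> (\<Sum>b\<in>Poly_Mapping.keys x. pm_scale (Poly_Mapping.lookup x b) (Poly_Mapping.single b 1))"
    by (simp only: sum_pm_scale_single)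
  then show ?thesis by (simp add: sum scale lin_ext_def)
qed

lemma lin_ext_lin_ext:
  assumes s: "vector_space s"
  shows "lin_ext s f (lin_ext pm_scale g x) = lin_ext s (\<lambda>b. lin_ext s f (g b)) x"
proof -
  interpret Vector_Spaces.linear pm_scale s "lin_ext s f" by (rule linear_lin_ext[OF s])
  show ?thesis by (subst (2) lin_ext_def) (simp add: sum scale lin_ext_def[of s "\<lambda>b. lin_ext s f (g b)"])
qed

lemma lin_ext_mult:
  assumes f: "\<And>a b. f (a + b) = f a * f b"
  shows "lin_ext (*) f (x * y) = lin_ext (*) f x * lin_ext (*) f y"
proof -
  interpret Vector_Spaces.linear pm_scale "(*)" "lin_ext (*) f"
    by (rule linear_lin_ext[OF vector_space_times])
  have "x * y = (\<Sum>a\<in>Poly_Mapping.keys x. pm_scale (Poly_Mapping.lookup x a) (Poly_Mapping.single a 1)) *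
      (\<Sum>b\<in>Poly_Mapping.keys y. pm_scale (Poly_Mapping.lookup y b) (Poly_Mapping.single b 1))"
    by (simp only: sum_pm_scale_single)
  also have "\<dots> = (\<Sum>a\<in>Poly_Mapping.keys x. \<Sum>b\<in>Poly_Mapping.keys y.
      pm_scale (Poly_Mapping.lookup x a * Poly_Mapping.lookup y b) (Poly_Mapping.single (a + b) 1))"
    by (simp add: sum_product pm_scale_single mult_single)
  finally have "lin_ext (*) f (x * y) = (\<Sum>a\<in>Poly_Mapping.keys x. \<Sum>b\<in>Poly_Mapping.keys y.
      (Poly_Mapping.lookup x a * Poly_Mapping.lookup y b) * f (a + b))"
    by (simp add: sum scale lin_ext_single)
  also have "\<dots> = (\<Sum>a\<in>Poly_Mapping.keys x. \<Sum>b\<in>Poly_Mapping.keys y.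
      (Poly_Mapping.lookup x a * f a) * (Poly_Mapping.lookup y b * f b))"
    by (intro sum.cong refl) (simp add: f)
  finally show ?thesis by (simp only: lin_ext_def sum_product)
qed

lemma lin_ext_character:
  assumes "\<And>a b. f (a + b) = f a * f b" "f 0 = 1"
  shows "lin_ext (*) f \<in> characters"
  using linear_lin_ext[OF vector_space_times, of f] lin_ext_mult[of f] assms
  by (simp add: characters_def lin_ext_single flip: single_one)


section \<open>Convolution on basis elements\<close>

lemma tensor_map_delta_graph:
  assumes s: "vector_space s"
  shows "tensor_map s \<phi> \<mu> (delta_graph G) =
    (\<Sum>r | r \<triangleleft> G. s (\<mu> (gbasis (restr_graph G r))) (\<phi> (gbasis (quot_graph G r))))"
proof -
  interpret vector_space s by (rule s)
  let ?f = "\<lambda>(a, b). s (\<mu> (Poly_Mapping.single b 1)) (\<phi> (Poly_Mapping.single a 1))"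
  interpret l: Vector_Spaces.linear pm_scale s "lin_ext s ?f" by (rule linear_lin_ext[OF s])
  show ?thesis
    unfolding tensor_map_def delta_graph_def l.sum by (simp add: lin_ext_single gbasis_def)
qed

lemma tensor_map_delta_gbasis:
  assumes "vector_space s" "fin_graph G"
  shows "(tensor_map s \<phi> \<mu> \<circ> delta) (gbasis G) =
    (\<Sum>r | r \<triangleleft> G. s (\<mu> (gbasis (restr_graph G r))) (\<phi> (gbasis (quot_graph G r))))"
  using assms by (simp add: delta_gbasis tensor_map_delta_graph)

text \<open>The composite with \<open>\<delta>\<close> is linear, hence determined by its values on classes, each of
  which is represented by a graph on natural numbers.\<close>
lemma tensor_map_delta_eqI:
  assumes s: "vector_space s"
    and eq: "\<And>G :: nat ugraph. fin_graph G \<Longrightarrow>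
      (\<Sum>r | r \<triangleleft> G. s (\<mu> (gbasis (restr_graph G r))) (\<phi> (gbasis (quot_graph G r)))) = f (iclass G)"
  shows "tensor_map s \<phi> \<mu> \<circ> delta = lin_ext s f"
proof
  fix x
  have "tensor_map s \<phi> \<mu> (idelta c) = f c" for c
  proof -
    obtain G :: "nat ugraph" where "fin_graph G" "iclass G = c" using iclass_surj by blast
    then have "idelta c = delta_graph G" using idelta_iclass[of G] by simp
    then show ?thesis
      using eq[OF \<open>fin_graph G\<close>] \<open>iclass G = c\<close> by (simp only: tensor_map_delta_graph[OF s])
  qed
  then show "(tensor_map s \<phi> \<mu> \<circ> delta) x = lin_ext s f x"
    unfolding comp_def delta_def tensor_map_def lin_ext_lin_ext[OF s] by simp
qed

text \<open>The analogue of the zeta function of a poset: the character with value 1 on all graphs. It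
  turns out to be the inverse of \<^const>\<open>lambda_chr\<close>.\<close>
definition zeta :: "galg \<Rightarrow> rat" where
  "zeta = lin_ext (*) (\<lambda>_. 1)"

lemma zeta_gbasis: "zeta (gbasis G) = 1"
  by (simp add: zeta_def gbasis_def lin_ext_single)

lemma zeta_character: "zeta \<in> characters"
  unfolding zeta_def by (rule lin_ext_character) simp_all

lemma lambda_chr_character: "lambda_chr \<in> characters"
  unfolding lambda_chr_def by (rule lin_ext_character) (simp_all add: ilambda_add ilambda_zero)

lemma conv_zeta_lambda_chr: "conv zeta lambda_chr = eps'"
  unfolding conv_def eps'_def
  by (rule tensor_map_delta_eqI[OF vector_space_times])
    (simp add: zeta_gbasis lambda_chr_gbasis fin_graph_restr_graph sum_lambda_restr_graph iedgeless_iclass)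

lemma conv_lambda_chr_zeta: "conv lambda_chr zeta = eps'"
  unfolding conv_def eps'_def
  by (rule tensor_map_delta_eqI[OF vector_space_times])
    (simp add: zeta_gbasis lambda_chr_gbasis fin_graph_quot_graph sum_lambda_quot_graph iedgeless_iclass)

lemma P_chr_eq_char_act: "P_chr = phi0 \<leftarrow>\<^sub>c lambda_chr"
proof -
  have "verts (quot_graph G r) = verts G // r" for G :: "nat ugraph" and r by (simp add: quot_graph_def)
  then show ?thesis
    unfolding char_act_def P_chr_def
    by (intro tensor_map_delta_eqI[OF vector_space_smult, symmetric])
      (simp add: lambda_chr_gbasis phi0_gbasis fin_graph_restr_graph fin_graph_quot_graph
        smult_monom ichrom_iclass chrom_poly_admissible cl_def)
qed


section \<open>Uniqueness of the inverse\<close>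

lemma restr_graph_conn:
  assumes G: "fin_graph G"
  shows "restr_graph G (conn (verts G) (edges G)) = G"
proof -
  have "edges (restr_graph G (conn (verts G) (edges G))) = edges G"
  proof
    show "edges G \<subseteq> edges (restr_graph G (conn (verts G) (edges G)))"
    proof
      fix e assume e: "e \<in> edges G"
      then obtain x y where xy: "e = {x, y}" by (rule edge_pair[OF G])
      then have "(x, y) \<in> conn (verts G) (edges G)"
        using e edge_verts[OF G, of x y] by (intro conn_edge) simp_all
      then show "e \<in> edges (restr_graph G (conn (verts G) (edges G)))"
        using e xy by (simp add: edge_restr_graph_iff[OF equiv_conn])
    qed
  qed (rule edges_restr_graph_subset)
  then show ?thesis by (simp add: prod_eq_iff) (simp add: restr_graph_def)
qed

lemma edges_quot_graph_conn:
  assumes G: "fin_graph G"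
  shows "edges (quot_graph G (conn (verts G) (edges G))) = {}"
proof (rule equals0I)
  fix e assume e: "e \<in> edges (quot_graph G (conn (verts G) (edges G)))"
  then obtain C D where "e = {C, D}" by (rule edge_pair[OF fin_graph_quot_graph[OF G]])
  then have "{C, D} \<in> edges (quot_graph G (conn (verts G) (edges G)))" using e by simp
  then show False
  proof (rule edge_quot_graphE[OF equiv_conn])
    fix u v assume uv: "{u, v} \<in> edges G" "u \<in> verts G" "v \<in> verts G"
      "conn (verts G) (edges G) `` {u} \<noteq> conn (verts G) (edges G) `` {v}"
    then have "(u, v) \<in> conn (verts G) (edges G)" by (simp add: conn_edge)
    then show False using uv(4) equiv_class_eq[OF equiv_conn] by metis
  qed
qed

lemma lambda_chr_graph_edgeless:
  assumes "fin_graph G" "edges G = {}"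
  shows "lambda_chr_graph G = 1"
proof -
  have "{F. F \<subseteq> {} \<and> conn (verts G) F = conn (verts G) {}} = {{}}" by auto
  then show ?thesis using assms by (simp add: lambda_chr_graph_Pow)
qed

text \<open>In the equation \<open>(\<lambda>_chr * y)(G) = \<epsilon>'(G)\<close> the partition \<open>t\<close> of \<open>G\<close> into components contributes
  \<open>\<lambda>_chr(G/t) y(G|t) = y(G)\<close>, as \<open>G/t\<close> has no edges and \<open>G|t = G\<close>. For every other \<open>r\<close> the graph \<open>G|r\<close>
  has fewer edges than \<open>G\<close>, so the value of \<open>y\<close> there is known by induction.\<close>
lemma right_inverse_lambda_chr_unique:
  assumes y: "y \<in> characters" and inv: "conv lambda_chr y = eps'"
  shows "y = zeta"
proof -
  have y1: "y (gbasis G) = 1" if "fin_graph G" for G :: "nat ugraph"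
    using that
  proof (induction "card (edges G)" arbitrary: G rule: less_induct)
    case (less G)
    note G = less.prems
    let ?t = "conn (verts G) (edges G)"
    let ?l = "\<lambda>r. lambda_chr_graph (quot_graph G r)"
    have t: "?t \<triangleleft> G" by (rule admissible_conn[OF G order_refl])
    have smaller: "y (gbasis (restr_graph G r)) = 1" if r: "r \<triangleleft> G" "r \<noteq> ?t" for r
    proof (rule less.hyps)
      show "fin_graph (restr_graph G r)" by (rule fin_graph_restr_graph[OF G])
      have "edges (restr_graph G r) \<noteq> edges G" using conn_restr_graph[OF G r(1)] r(2) by metis
      then have "edges (restr_graph G r) \<subset> edges G" using edges_restr_graph_subset by blast
      then show "card (edges (restr_graph G r)) < card (edges G)"
        by (rule psubset_card_mono[OF finite_edges[OF G]])
    qed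
    have "(\<Sum>r | r \<triangleleft> G. y (gbasis (restr_graph G r)) * ?l r) = conv lambda_chr y (gbasis G)"
      unfolding conv_def tensor_map_delta_gbasis[OF vector_space_times G]
      by (simp add: lambda_chr_gbasis fin_graph_quot_graph[OF G])
    also have "\<dots> = (\<Sum>r | r \<triangleleft> G. ?l r)"
      by (simp add: inv eps'_gbasis[OF G] sum_lambda_quot_graph[OF G])
    \<comment> \<open>The same equation holds for \<open>\<zeta>\<close>; in the difference of the two only the term of \<open>t\<close> survives.\<close>
    finally have "0 = (\<Sum>r | r \<triangleleft> G. (y (gbasis (restr_graph G r)) - 1) * ?l r)"
      by (simp add: left_diff_distrib sum_subtractf)
    also have "\<dots> = (\<Sum>r\<in>{?t}. (y (gbasis (restr_graph G r)) - 1) * ?l r)"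
      using t smaller finite_admissible[OF G] by (intro sum.mono_neutral_right) auto
    also have "\<dots> = y (gbasis G) - 1"
      by (simp add: restr_graph_conn[OF G]
          lambda_chr_graph_edgeless[OF fin_graph_quot_graph[OF G] edges_quot_graph_conn[OF G]])
    finally show ?case by simp
  qed
  have single: "y (Poly_Mapping.single c 1) = 1" for c
  proof -
    obtain G :: "nat ugraph" where "fin_graph G" "iclass G = c" using iclass_surj by blast
    then show ?thesis using y1[of G] by (simp add: gbasis_def)
  qed
  have lin: "Vector_Spaces.linear pm_scale (*) y" using y by (simp add: characters_def)
  show ?thesis unfolding zeta_def by (rule ext) (rule linear_eq_lin_ext[OF lin, unfolded single])
qed

lemma inv_lambda_chr: "inv\<^bsub>char_monoid\<^esub> lambda_chr = zeta"
  unfolding m_inv_def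
proof (rule the_equality)
  show "zeta \<in> carrier char_monoid \<and> lambda_chr \<otimes>\<^bsub>char_monoid\<^esub> zeta = \<one>\<^bsub>char_monoid\<^esub>
      \<and> zeta \<otimes>\<^bsub>char_monoid\<^esub> lambda_chr = \<one>\<^bsub>char_monoid\<^esub>"
    by (simp add: char_monoid_def zeta_character conv_zeta_lambda_chr conv_lambda_chr_zeta)
  fix y
  assume "y \<in> carrier char_monoid \<and> lambda_chr \<otimes>\<^bsub>char_monoid\<^esub> y = \<one>\<^bsub>char_monoid\<^esub>
      \<and> y \<otimes>\<^bsub>char_monoid\<^esub> lambda_chr = \<one>\<^bsub>char_monoid\<^esub>"
  then have "y \<in> characters" "conv lambda_chr y = eps'" by (simp_all add: char_monoid_def)
  then show "y = zeta" by (rule right_inverse_lambda_chr_unique)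
qed

theorem corollary2p5:
  shows "lambda_chr \<in> Units char_monoid
    \<and> (\<forall>G :: 'a ugraph. fin_graph G \<longrightarrow> (inv\<^bsub>char_monoid\<^esub> lambda_chr) (gbasis G) = 1)
    \<and> (\<forall>G :: 'a ugraph. fin_graph G \<longrightarrow>
          (\<Sum>r | r \<triangleleft> G. lambda_chr (gbasis (quot_graph G r))) = eps' (gbasis G)
        \<and> (\<Sum>r | r \<triangleleft> G. lambda_chr (gbasis (restr_graph G r))) = eps' (gbasis G))
    \<and> P_chr = phi0 \<leftarrow>\<^sub>c lambda_chr
    \<and> (\<forall>G :: 'a ugraph. fin_graph G \<longrightarrow>
          P_chr (gbasis G) =
            (\<Sum>r | r \<triangleleft> G. smult (lambda_chr (gbasis (restr_graph G r))) (monom 1 (cl G r))))"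
proof (intro conjI allI impI)
  show "lambda_chr \<in> Units char_monoid"
    using lambda_chr_character zeta_character conv_zeta_lambda_chr conv_lambda_chr_zeta
    by (auto simp: Units_def char_monoid_def)
  show "P_chr = phi0 \<leftarrow>\<^sub>c lambda_chr" by (rule P_chr_eq_char_act)
  fix G :: "'a ugraph" assume G: "fin_graph G"
  show "(inv\<^bsub>char_monoid\<^esub> lambda_chr) (gbasis G) = 1" by (simp add: inv_lambda_chr zeta_gbasis)
  show "(\<Sum>r | r \<triangleleft> G. lambda_chr (gbasis (quot_graph G r))) = eps' (gbasis G)"
    by (simp add: lambda_chr_gbasis fin_graph_quot_graph G sum_lambda_quot_graph eps'_gbasis)
  show "(\<Sum>r | r \<triangleleft> G. lambda_chr (gbasis (restr_graph G r))) = eps' (gbasis G)"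
    by (simp add: lambda_chr_gbasis fin_graph_restr_graph G sum_lambda_restr_graph eps'_gbasis)
  show "P_chr (gbasis G) =
      (\<Sum>r | r \<triangleleft> G. smult (lambda_chr (gbasis (restr_graph G r))) (monom 1 (cl G r)))"
    by (simp add: P_chr_gbasis lambda_chr_gbasis fin_graph_restr_graph G chrom_poly_admissible smult_monom)
qed

end
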